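(* Let $G$ be a finite group. If $G$ has the cut-property, then either $2$ or $3 \in \pi(G)$. Furthermore, if $G$ is nilpotent, then $\pi(G) \subseteq \{2, 3\}$.
   Context: For a finite group $G$, let $\mathcal{U}(\mathbb{Z}[G])$ denote the group of units of the integral group ring $\mathbb{Z}[G]$ and $\mathcal{Z}(\cdot)$ the centre of a group. A finite group $G$ has the cut-property if all central units of $\mathbb{Z}[G]$ are trivial, i.e. $\mathcal{Z}(\mathcal{U}(\mathbb{Z}[G])) = \pm\mathcal{Z}(G) = \{\pm g : g \in \mathcal{Z}(G)\}$. $\pi(G)$ denotes the set of primes dividing the order of $G$.
   Formalization: The claim that 2 or 3 lies in π(G) is stated for nontrivial G only: the trivial group has the cut-property (the units of ℤ are ±1), but its π(G) is empty. *)

theory Defs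
  imports "HOL-Algebra.Generated_Groups" "HOL-Algebra.Ring" "HOL-Computational_Algebra.Primes"
begin

definition group_center :: "('a, 'b) monoid_scheme \<Rightarrow> 'a set" where
  "group_center G = {z \<in> carrier G. \<forall>g \<in> carrier G. z \<otimes>\<^bsub>G\<^esub> g = g \<otimes>\<^bsub>G\<^esub> z}"

text \<open>
  Elements of the integral group ring are the integer-valued functions of finite support contained
  in the group; they are extended by 0 to the whole underlying type, so that
  equality of functions is equality in the group ring. The product is convolution,
  \<open>(f g)(x) = \<Sum>y. f(y) g(y\<inverse> x)\<close>, summed over the support of \<open>f\<close>.
\<close>

definition integral_group_ring :: "('a, 'b) monoid_scheme \<Rightarrow> ('a \<Rightarrow> int) ring" where
  "integral_group_ring G =
    \<lparr>carrier = {f. finite {x. f x \<noteq> 0} \<and> {x. f x \<noteq> 0} \<subseteq> carrier G},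
     monoid.mult = (\<lambda>f g x. if x \<in> carrier G
               then \<Sum>y\<in>{y. f y \<noteq> 0}. f y * g (inv\<^bsub>G\<^esub> y \<otimes>\<^bsub>G\<^esub> x) else 0),
     one = (\<lambda>x. if x = \<one>\<^bsub>G\<^esub> then 1 else 0),
     zero = (\<lambda>x. 0),
     add = (\<lambda>f g x. f x + g x)\<rparr>"

definition group_ring_of :: "'a \<Rightarrow> 'a \<Rightarrow> int" where
  "group_ring_of g = (\<lambda>x. if x = g then 1 else 0)"

definition cut_property :: "('a, 'b) monoid_scheme \<Rightarrow> bool" where
  "cut_property G \<longleftrightarrow>
    group_center (units_of (integral_group_ring G)) =
      group_ring_of ` group_center G \<union>
      (\<lambda>g. \<ominus>\<^bsub>integral_group_ring G\<^esub> group_ring_of g) ` group_center G"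

definition order_primes :: "('a, 'b) monoid_scheme \<Rightarrow> nat set" where
  "order_primes G = {p. prime p \<and> p dvd order G}"

definition commutator_subgroup :: "('a, 'b) monoid_scheme \<Rightarrow> 'a set \<Rightarrow> 'a set \<Rightarrow> 'a set" where
  "commutator_subgroup G H K =
    generate G (\<Union>h\<in>H. \<Union>k\<in>K. {h \<otimes>\<^bsub>G\<^esub> k \<otimes>\<^bsub>G\<^esub> inv\<^bsub>G\<^esub> h \<otimes>\<^bsub>G\<^esub> inv\<^bsub>G\<^esub> k})"

text \<open>The index is shifted: \<open>lower_central G 0\<close> is the whole group.\<close>

primrec lower_central :: "('a, 'b) monoid_scheme \<Rightarrow> nat \<Rightarrow> 'a set" where
  "lower_central G 0 = carrier G"
| "lower_central G (Suc n) = commutator_subgroup G (lower_central G n) (carrier G)"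

definition nilpotent_group :: "('a, 'b) monoid_scheme \<Rightarrow> bool" where
  "nilpotent_group G \<longleftrightarrow> (\<exists>n. lower_central G n = {\<one>\<^bsub>G\<^esub>})"

lemma integral_group_ring_finite:
  assumes "group G" "finite (carrier G)"
  shows carrier_integral_group_ring_finite:
      "carrier (integral_group_ring G) = {f. \<forall>x. x \<notin> carrier G \<longrightarrow> f x = 0}"
    and mult_integral_group_ring_finite:
      "f \<in> carrier (integral_group_ring G) \<Longrightarrow>
       f \<otimes>\<^bsub>integral_group_ring G\<^esub> g =
         (\<lambda>x. if x \<in> carrier G
              then \<Sum>y\<in>carrier G. f y * g (inv\<^bsub>G\<^esub> y \<otimes>\<^bsub>G\<^esub> x) else 0)"
proof -
  show "carrier (integral_group_ring G) = {f. \<forall>x. x \<notin> carrier G \<longrightarrow> f x = 0}"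
    by (auto simp: integral_group_ring_def intro: finite_subset[OF _ assms(2)])
  show "f \<otimes>\<^bsub>integral_group_ring G\<^esub> g =
         (\<lambda>x. if x \<in> carrier G
              then \<Sum>y\<in>carrier G. f y * g (inv\<^bsub>G\<^esub> y \<otimes>\<^bsub>G\<^esub> x) else 0)"
    if "f \<in> carrier (integral_group_ring G)"
  proof
    fix x
    have "(\<Sum>y\<in>{y. f y \<noteq> 0}. f y * g (inv\<^bsub>G\<^esub> y \<otimes>\<^bsub>G\<^esub> x)) =
          (\<Sum>y\<in>carrier G. f y * g (inv\<^bsub>G\<^esub> y \<otimes>\<^bsub>G\<^esub> x))"
      using that assms(2) by (intro sum.mono_neutral_left) (auto simp: integral_group_ring_def)
    then show "(f \<otimes>\<^bsub>integral_group_ring G\<^esub> g) x =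
       (if x \<in> carrier G
        then \<Sum>y\<in>carrier G. f y * g (inv\<^bsub>G\<^esub> y \<otimes>\<^bsub>G\<^esub> x) else 0)"
      by (simp add: integral_group_ring_def)
  qed
qed

lemma ring_integral_group_ring:
  assumes "group G" "finite (carrier G)"
  shows "ring (integral_group_ring G)"
proof -
  interpret group G by fact
  let ?R = "integral_group_ring G"
  note car = carrier_integral_group_ring_finite[OF assms]
  note mul = mult_integral_group_ring_finite[OF assms]
  have add: "f \<oplus>\<^bsub>?R\<^esub> g = (\<lambda>x. f x + g x)" for f g
    by (simp add: integral_group_ring_def)
  have zero: "\<zero>\<^bsub>?R\<^esub> = (\<lambda>x. 0)" and one: "\<one>\<^bsub>?R\<^esub> = (\<lambda>x. if x = \<one>\<^bsub>G\<^esub> then 1 else 0)"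
    by (simp_all add: integral_group_ring_def)
  have closed: "f \<otimes>\<^bsub>?R\<^esub> g \<in> carrier ?R" if "f \<in> carrier ?R" for f g
    using that by (simp add: mul) (simp add: car)
  have onecl: "\<one>\<^bsub>?R\<^esub> \<in> carrier ?R"
    by (auto simp: car one)
  have shift: "(\<Sum>y\<in>carrier G. h y) = (\<Sum>y\<in>carrier G. h (inv\<^bsub>G\<^esub> a \<otimes>\<^bsub>G\<^esub> y))"
    if "a \<in> carrier G" for a and h :: "'a \<Rightarrow> int"
    using that
    by (intro sum.reindex_bij_witness[of _ "\<lambda>y. inv\<^bsub>G\<^esub> a \<otimes>\<^bsub>G\<^esub> y" "\<lambda>y. a \<otimes>\<^bsub>G\<^esub> y"])
       (auto simp: m_assoc[symmetric])
  show ?thesis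
  proof (rule ringI)
    show "abelian_group ?R"
    proof (rule abelian_groupI)
      fix f assume "f \<in> carrier ?R"
      then show "\<exists>g\<in>carrier ?R. g \<oplus>\<^bsub>?R\<^esub> f = \<zero>\<^bsub>?R\<^esub>"
        by (intro bexI[of _ "\<lambda>x. - f x"]) (auto simp: car add zero)
    qed (auto simp: car add zero algebra_simps)
    show "monoid ?R"
    proof (rule monoidI)
      fix f g h assume f: "f \<in> carrier ?R" and g: "g \<in> carrier ?R" and h: "h \<in> carrier ?R"
      show "f \<otimes>\<^bsub>?R\<^esub> g \<otimes>\<^bsub>?R\<^esub> h = f \<otimes>\<^bsub>?R\<^esub> (g \<otimes>\<^bsub>?R\<^esub> h)"
      proof
        fix x
        show "(f \<otimes>\<^bsub>?R\<^esub> g \<otimes>\<^bsub>?R\<^esub> h) x = (f \<otimes>\<^bsub>?R\<^esub> (g \<otimes>\<^bsub>?R\<^esub> h)) x"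
        proof (cases "x \<in> carrier G")
          case True
          have "(f \<otimes>\<^bsub>?R\<^esub> g \<otimes>\<^bsub>?R\<^esub> h) x =
            (\<Sum>z\<in>carrier G. \<Sum>y\<in>carrier G. f y * g (inv\<^bsub>G\<^esub> y \<otimes>\<^bsub>G\<^esub> z) * h (inv\<^bsub>G\<^esub> z \<otimes>\<^bsub>G\<^esub> x))"
            using True by (subst mul[OF closed[OF f]]) (simp add: mul[OF f] sum_distrib_right)
          also have "\<dots> = (\<Sum>y\<in>carrier G. \<Sum>z\<in>carrier G.
              f y * (g (inv\<^bsub>G\<^esub> y \<otimes>\<^bsub>G\<^esub> z) * h (inv\<^bsub>G\<^esub> z \<otimes>\<^bsub>G\<^esub> x)))"
            by (subst sum.swap) (simp add: mult.assoc)
          also have "\<dots> = (\<Sum>y\<in>carrier G. f y * (g \<otimes>\<^bsub>?R\<^esub> h) (inv\<^bsub>G\<^esub> y \<otimes>\<^bsub>G\<^esub> x))"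
          proof (rule sum.cong[OF refl])
            fix y assume y: "y \<in> carrier G"
            have "(g \<otimes>\<^bsub>?R\<^esub> h) (inv\<^bsub>G\<^esub> y \<otimes>\<^bsub>G\<^esub> x) =
              (\<Sum>z\<in>carrier G. g (inv\<^bsub>G\<^esub> y \<otimes>\<^bsub>G\<^esub> z) *
                 h (inv\<^bsub>G\<^esub> (inv\<^bsub>G\<^esub> y \<otimes>\<^bsub>G\<^esub> z) \<otimes>\<^bsub>G\<^esub> (inv\<^bsub>G\<^esub> y \<otimes>\<^bsub>G\<^esub> x)))"
              using True y by (simp add: mul[OF g])
                 (rule shift[OF y, of "\<lambda>z. g z * h (inv\<^bsub>G\<^esub> z \<otimes>\<^bsub>G\<^esub> (inv\<^bsub>G\<^esub> y \<otimes>\<^bsub>G\<^esub> x))"])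
            also have "\<dots> = (\<Sum>z\<in>carrier G. g (inv\<^bsub>G\<^esub> y \<otimes>\<^bsub>G\<^esub> z) * h (inv\<^bsub>G\<^esub> z \<otimes>\<^bsub>G\<^esub> x))"
            proof (rule sum.cong[OF refl])
              fix z assume z: "z \<in> carrier G"
              have "inv\<^bsub>G\<^esub> (inv\<^bsub>G\<^esub> y \<otimes>\<^bsub>G\<^esub> z) \<otimes>\<^bsub>G\<^esub> (inv\<^bsub>G\<^esub> y \<otimes>\<^bsub>G\<^esub> x) = inv\<^bsub>G\<^esub> z \<otimes>\<^bsub>G\<^esub> x"
                using y z True
                by (simp add: inv_mult_group m_assoc) (simp add: m_assoc[symmetric])
              then show "g (inv\<^bsub>G\<^esub> y \<otimes>\<^bsub>G\<^esub> z) *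
                 h (inv\<^bsub>G\<^esub> (inv\<^bsub>G\<^esub> y \<otimes>\<^bsub>G\<^esub> z) \<otimes>\<^bsub>G\<^esub> (inv\<^bsub>G\<^esub> y \<otimes>\<^bsub>G\<^esub> x)) =
                 g (inv\<^bsub>G\<^esub> y \<otimes>\<^bsub>G\<^esub> z) * h (inv\<^bsub>G\<^esub> z \<otimes>\<^bsub>G\<^esub> x)" by simp
            qed
            finally show "(\<Sum>z\<in>carrier G. f y * (g (inv\<^bsub>G\<^esub> y \<otimes>\<^bsub>G\<^esub> z) * h (inv\<^bsub>G\<^esub> z \<otimes>\<^bsub>G\<^esub> x))) =
              f y * (g \<otimes>\<^bsub>?R\<^esub> h) (inv\<^bsub>G\<^esub> y \<otimes>\<^bsub>G\<^esub> x)"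
              by (simp add: sum_distrib_left)
          qed
          finally show ?thesis
            using True by (simp add: mul[OF f])
        qed (simp add: integral_group_ring_def)
      qed
    next
      fix f assume f: "f \<in> carrier ?R"
      show "\<one>\<^bsub>?R\<^esub> \<otimes>\<^bsub>?R\<^esub> f = f"
      proof
        fix x
        have "(\<Sum>y\<in>carrier G. \<one>\<^bsub>?R\<^esub> y * f (inv\<^bsub>G\<^esub> y \<otimes>\<^bsub>G\<^esub> x)) =
              (\<Sum>y\<in>carrier G. if y = \<one>\<^bsub>G\<^esub> then f (inv\<^bsub>G\<^esub> y \<otimes>\<^bsub>G\<^esub> x) else 0)"
          by (rule sum.cong) (auto simp: one)
        then show "(\<one>\<^bsub>?R\<^esub> \<otimes>\<^bsub>?R\<^esub> f) x = f x"
          using assms(2) f by (auto simp: mul[OF onecl] car)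
      qed
      show "f \<otimes>\<^bsub>?R\<^esub> \<one>\<^bsub>?R\<^esub> = f"
      proof
        fix x
        have "(\<Sum>y\<in>carrier G. f y * \<one>\<^bsub>?R\<^esub> (inv\<^bsub>G\<^esub> y \<otimes>\<^bsub>G\<^esub> x)) =
              (\<Sum>y\<in>carrier G. if y = x then f y else 0)" if x: "x \<in> carrier G"
        proof (rule sum.cong[OF refl])
          fix y assume y: "y \<in> carrier G"
          have "inv\<^bsub>G\<^esub> y \<otimes>\<^bsub>G\<^esub> x = \<one>\<^bsub>G\<^esub> \<longleftrightarrow> y = x"
            using x y by (metis inv_closed inv_inv inv_equality l_inv)
          then show "f y * \<one>\<^bsub>?R\<^esub> (inv\<^bsub>G\<^esub> y \<otimes>\<^bsub>G\<^esub> x) = (if y = x then f y else 0)"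
            by (simp add: one)
        qed
        then show "(f \<otimes>\<^bsub>?R\<^esub> \<one>\<^bsub>?R\<^esub>) x = f x"
          using assms(2) f by (auto simp: mul[OF f] car)
      qed
    qed (use closed onecl in auto)
  next
    fix f g h assume f: "f \<in> carrier ?R" and g: "g \<in> carrier ?R" and h: "h \<in> carrier ?R"
    have fg: "(\<lambda>x. f x + g x) \<in> carrier ?R"
      using f g by (simp add: car)
    show "(f \<oplus>\<^bsub>?R\<^esub> g) \<otimes>\<^bsub>?R\<^esub> h = f \<otimes>\<^bsub>?R\<^esub> h \<oplus>\<^bsub>?R\<^esub> g \<otimes>\<^bsub>?R\<^esub> h"
      by (auto simp: add mul[OF f] mul[OF g] mul[OF fg] sum.distrib algebra_simps)
    show "h \<otimes>\<^bsub>?R\<^esub> (f \<oplus>\<^bsub>?R\<^esub> g) = h \<otimes>\<^bsub>?R\<^esub> f \<oplus>\<^bsub>?R\<^esub> h \<otimes>\<^bsub>?R\<^esub> g"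
      by (auto simp: add mul[OF h] sum.distrib algebra_simps)
  qed
qed

end

theory Submission
  imports
    Defs
    "HOL-Algebra.Sylow"
    "HOL-Algebra.Multiplicative_Group"
    "HOL-Number_Theory.Number_Theory"
    "HOL-Computational_Algebra.Field_as_Ring"
    "Subresultants.Subresultant_Gcd"
    "Jordan_Normal_Form.Char_Poly"
begin

text \<open>
  Call an element \<open>x\<close> of prime order \<open>p\<close> rigid if it is conjugate to none of its powers except
  itself. Both claims follow from one fact (\<open>rigid_imp_not_cut\<close>): a finite group with a rigid
  element of prime order \<open>p \<ge> 5\<close> has a nontrivial central unit. Indeed, if \<open>p\<close> is the smallest
  prime divisor of \<open>|G|\<close>, then a conjugation acts on the subgroup generated by \<open>x\<close> through an
  automorphism whose order divides both \<open>|G|\<close> and \<open>p - 1\<close>, hence trivially; and in a nilpotent group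
  a relation \<open>g x g\<inverse> = x\<^sup>j\<close> puts \<open>x\<close> to the power \<open>(1 - j)\<^sup>n\<close> into the \<open>n\<close>-th term of the lower
  central series, which forces \<open>j \<equiv> 1\<close> modulo \<open>p\<close>. In either case all elements of order \<open>p\<close> are rigid.

  To find the unit, let \<open>K\<close> be the union of the conjugacy classes of \<open>x\<close> and \<open>x\<inverse>\<close>, and \<open>t\<close> the sum
  of the elements of \<open>K\<close>. This is a central element of the group ring, and left multiplication by \<open>t\<close>
  is a symmetric integer matrix. So its eigenvalues are real, and a polynomial in \<open>t\<close> is determined by
  its values at the eigenvalues (\<open>mat_poly_eq_0_iff_symmetric\<close>).

  Suppose first that some eigenvalue is irrational. It generates a totally real number field of degree
  at least 2, and the argument of Dirichlet's unit theorem yields a unit other than \<open>\<plusminus>1\<close> there, which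
  can be chosen so that it lifts to a unit \<open>P(t)\<close> of \<open>\<int>[t]\<close> with \<open>P(t)\<^sup>2 \<noteq> 1\<close>
  (\<open>integer_roots_or_unit\<close>). The unit \<open>P(t)\<close> is central and invariant under inversion of group
  elements; a trivial unit \<open>\<plusminus>g\<close> with this invariance has \<open>g = g\<inverse>\<close>, hence square 1. So \<open>P(t)\<close> is not
  trivial.

  Suppose now that all eigenvalues are integers. By Fermat's little theorem, \<open>t\<^sup>q \<equiv> t\<close> modulo every
  large prime \<open>q\<close> (\<open>symmetric_integer_eigenvalues_frobenius\<close>). On the other hand, counting words up to
  rotation shows that \<open>t\<^sup>q\<close> is congruent modulo \<open>q\<close>, on sums over conjugacy classes, to the sum of the
  \<open>q\<close>-th powers of the elements of \<open>K\<close> (\<open>class_sum_indicator_pow_cong\<close>). So \<open>x\<^sup>q\<close> must lie in \<open>K\<close>,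
  which for a rigid \<open>x\<close> means \<open>q \<equiv> \<plusminus>1\<close> modulo \<open>p\<close>. But for \<open>p \<ge> 5\<close> there are arbitrarily large
  primes \<open>q\<close> that are not \<open>\<plusminus>1\<close> modulo \<open>p\<close>.
\<close>

section \<open>Values of integer polynomials at algebraic numbers\<close>

text \<open>
  Henceforth \<open>coeff\<close> and \<open>monom\<close> refer to the type \<open>'a poly\<close>, and \<open>order\<close> to groups.
\<close>

hide_const (open) up_ring.coeff up_ring.monom Polynomial.order

abbreviation ipoly :: "int poly \<Rightarrow> 'a::comm_ring_1 \<Rightarrow> 'a" where
  "ipoly P x \<equiv> poly (of_int_poly P) x"

definition totally_real :: "int poly \<Rightarrow> bool" where
  "totally_real f \<longleftrightarrow> (\<forall>z::complex. ipoly f z = 0 \<longrightarrow> z \<in> \<real>)"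

lemma ipoly_of_real: "ipoly P (complex_of_real x) = complex_of_real (ipoly P x)"
  by (induction P) auto

lemma ipoly_pCons [simp]: "ipoly (pCons a P) x = of_int a + x * ipoly P x"
  by (simp add: of_int_hom.map_poly_pCons_hom)

lemma ipoly_smult: "ipoly (smult c P) x = of_int c * ipoly P x"
  by (induction P) (auto simp: algebra_simps)

text \<open>
  A common root makes the resultant vanish over the complex numbers, hence over the integers, so \<open>f\<close>
  and \<open>a\<close> have a common factor of positive degree. As \<open>f\<close> is irreducible, this factor is \<open>f\<close> up to sign.
\<close>

lemma common_root_imp_dvd:
  fixes f a :: "int poly" and z :: complex
  assumes f: "irreducible f" and fz: "ipoly f z = 0" and az: "ipoly a z = 0"
  shows "f dvd a"
proof -
  let ?F = "of_int_poly f :: complex poly" and ?A = "of_int_poly a :: complex poly"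
  have nz: "?F \<noteq> 0" using f by auto
  have "[:-z, 1:] dvd gcd ?F ?A"
    using fz az by (simp add: poly_eq_0_iff_dvd)
  then have "degree (gcd ?F ?A) \<noteq> 0"
    using nz by (metis gcd_eq_0_iff degree_pCons_eq_if dvd_imp_degree_le not_one_le_zero one_neq_zero pCons_eq_0_iff One_nat_def degree_0)
  then have "resultant ?F ?A = 0" by (simp add: resultant_0_gcd)
  then have "resultant f a = 0" by (simp add: of_int_hom.resultant_hom)
  then have deg: "degree (gcd f a) \<noteq> 0" by (simp add: resultant_0_gcd)
  then have "\<not> is_unit (gcd f a)" by (auto simp: is_unit_poly_iff)
  then have "f dvd gcd f a" using irreducibleD'[OF f, of "gcd f a"] by auto
  then show ?thesis by simp
qed

text \<open>
  An irreducible polynomial has no root in common with its derivative, because the latter has smaller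
  degree. So the complex roots are simple, and total reality turns them into real ones.
\<close>

lemma card_real_roots_irreducible:
  assumes f: "irreducible f" and d: "degree f > 0" and tr: "totally_real f"
  shows "finite {x::real. ipoly f x = 0} \<and> card {x::real. ipoly f x = 0} = degree f"
proof -
  let ?F = "of_int_poly f :: complex poly"
  have "rsquarefree ?F"
    unfolding rsquarefree_roots
  proof (intro allI notI, elim conjE)
    fix z assume z: "ipoly f z = 0" "poly (pderiv ?F) z = 0"
    have "pderiv ?F = of_int_poly (pderiv f)"
      by (rule poly_eqI) (simp add: coeff_pderiv)
    with z common_root_imp_dvd[OF f, of z "pderiv f"] have "f dvd pderiv f" by simp
    moreover have "pderiv f \<noteq> 0" using d by (simp add: pderiv_eq_0_iff)
    ultimately have "degree f \<le> degree (pderiv f)" by (rule dvd_imp_degree_le)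
    then show False using d by (simp add: degree_pderiv)
  qed
  then have "degree ?F = degree (smult (lead_coeff ?F) (\<Prod>z|poly ?F z = 0. [:-z, 1:]))"
    by (simp only: complex_poly_decompose_rsquarefree)
  moreover have "?F \<noteq> 0" using f by auto
  ultimately have "degree f = card {z::complex. ipoly f z = 0}"
    using poly_roots_finite[of ?F] by (simp add: degree_prod_eq_sum_degree)
  moreover have *: "{z::complex. ipoly f z = 0} = complex_of_real ` {x. ipoly f x = 0}"
    using tr by (auto simp: totally_real_def ipoly_of_real image_iff elim!: Reals_cases)
  moreover have "card (complex_of_real ` {x. ipoly f x = 0}) = card {x::real. ipoly f x = 0}"
    by (rule card_image) (simp add: inj_on_def)
  moreover have "finite {x::real. ipoly f x = 0}"
    using f by (intro poly_roots_finite) auto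
  ultimately show ?thesis by simp
qed

lemma ipoly_as_sum:
  assumes "degree p < d \<or> p = 0"
  shows "ipoly p (x::'a::{comm_ring_1}) = (\<Sum>l<d. of_int (coeff p l) * x ^ l)"
proof -
  have "ipoly p x = (\<Sum>l\<le>degree (of_int_poly p :: 'a poly). of_int (coeff p l) * x ^ l)"
    by (simp add: poly_altdef)
  also have "\<dots> = (\<Sum>l<d. of_int (coeff p l) * x ^ l)"
  proof (cases "p = 0")
    case False
    have le: "degree (of_int_poly p :: 'a poly) \<le> degree p" by (simp add: degree_map_poly_le)
    have "of_int (coeff p l) = (0::'a)" if "l > degree (of_int_poly p :: 'a poly)" for l
      using coeff_eq_0[OF that] by simp
    then show ?thesis using le assms False
      by (intro sum.mono_neutral_left) (auto simp: not_le)
  qed auto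
  finally show ?thesis .
qed

text \<open>
  Division with remainder by a monic polynomial \<open>f\<close> of degree \<open>d\<close>: the powers of a root with exponents
  below \<open>d\<close> span all polynomial values over the integers, with coefficients that do not depend on the
  root.
\<close>

lemma reduce_at_roots:
  fixes f p :: "int poly"
  assumes m: "lead_coeff f = 1"
  obtains c :: "nat \<Rightarrow> int"
  where "\<And>\<theta>::real. ipoly f \<theta> = 0 \<Longrightarrow> ipoly p \<theta> = (\<Sum>l<degree f. of_int (c l) * \<theta> ^ l)"
proof -
  obtain q r where qr: "pseudo_divmod p f = (q, r)" by fastforce
  have "f \<noteq> 0" using m by auto
  from pseudo_divmod[OF this qr] m
  have p: "p = f * q + r" and r: "r = 0 \<or> degree r < degree f" by auto
  show ?thesis
  proof (rule that[of "coeff r"])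
    fix \<theta> :: real assume "ipoly f \<theta> = 0"
    then have "ipoly p \<theta> = ipoly r \<theta>" by (simp add: p of_int_poly_hom.hom_mult of_int_poly_hom.hom_add)
    then show "ipoly p \<theta> = (\<Sum>l<degree f. of_int (coeff r l) * \<theta> ^ l)"
      using ipoly_as_sum[of r "degree f" \<theta>] r by auto
  qed
qed

text \<open>
  A vanishing determinant would yield a nonzero polynomial of degree less than \<open>d\<close> with \<open>d\<close> roots.
\<close>

lemma det_vandermonde_nonzero:
  fixes t :: "nat \<Rightarrow> real"
  assumes inj: "inj_on t {..<d}"
  shows "det (mat d d (\<lambda>(l, i). t i ^ l)) \<noteq> 0"
proof
  let ?W = "mat d d (\<lambda>(l, i). t i ^ l)"
  assume "det ?W = 0"
  then have "det (transpose_mat ?W) = 0" by (subst det_transpose[of _ d]) auto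
  then obtain v where v: "v \<in> carrier_vec d" "v \<noteq> 0\<^sub>v d" and W: "transpose_mat ?W *\<^sub>v v = 0\<^sub>v d"
    by (subst (asm) det_0_iff_vec_prod_zero[of _ d]) auto
  define p where "p = (\<Sum>l<d. monom (v $ l) l)"
  have cp: "coeff p l = (if l < d then v $ l else 0)" for l
    by (simp add: p_def coeff_sum if_distrib cong: if_cong)
  have root: "poly p (t i) = 0" if i: "i < d" for i
  proof -
    have "(transpose_mat ?W *\<^sub>v v) $ i = (\<Sum>l<d. t i ^ l * v $ l)"
      using i v by (auto simp: scalar_prod_def atLeast0LessThan intro!: sum.cong)
    then show ?thesis using i W by (simp add: p_def poly_sum poly_monom mult.commute)
  qed
  obtain l where l: "l < d" "v $ l \<noteq> 0" using v by (metis eq_vecI carrier_vecD index_zero_vec)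
  then have p0: "p \<noteq> 0" using cp[of l] by auto
  have "t ` {..<d} \<subseteq> {x. poly p x = 0}" using root by auto
  then have "d \<le> card {x. poly p x = 0}"
    using card_mono[OF poly_roots_finite[OF p0]] inj by (metis card_image card_lessThan)
  also have "\<dots> \<le> degree p" by (rule card_poly_roots_bound[OF p0])
  also have "degree p < d"
    using l cp p0 by (metis leading_coeff_0_iff)
  finally show False by simp
qed

text \<open>
  Multiplication by \<open>a\<close> on \<open>\<int>[X]/(f)\<close> is an integer matrix \<open>A\<close>, and the Vandermonde matrix of the
  roots of \<open>f\<close> diagonalises it, with the values of \<open>a\<close> at the roots as eigenvalues. So the norm of \<open>a\<close> is
  the integer \<open>N = det A\<close>. The first row of the adjugate of \<open>A\<close> provides \<open>b\<close>: the norm of \<open>a\<close> is a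
  multiple of \<open>a\<close> already with integer coefficients.
\<close>

lemma norm_of_polynomial_value:
  fixes f a :: "int poly" and \<Theta> :: "real set"
  defines "\<Theta> \<equiv> {x::real. ipoly f x = 0}"
  assumes m: "lead_coeff f = 1" and d: "degree f > 0" and card: "card \<Theta> = degree f"
  obtains N :: int and b :: "int poly"
  where "of_int N = (\<Prod>\<theta>\<in>\<Theta>. ipoly a \<theta>)"
    and "\<And>\<theta>. \<theta> \<in> \<Theta> \<Longrightarrow> ipoly a \<theta> * ipoly b \<theta> = of_int N"
proof -
  define d where "d = degree f"
  have d0: "d > 0" using d by (simp add: d_def)
  have "finite \<Theta>" using card d by (metis card.infinite less_irrefl)
  then obtain t where t: "bij_betw t {..<d} \<Theta>"
    using card by (metis d_def ex_bij_betw_nat_finite atLeast0LessThan)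
  then have inj: "inj_on t {..<d}" and im: "t ` {..<d} = \<Theta>" by (auto simp: bij_betw_def)
  have "\<forall>k. \<exists>c :: nat \<Rightarrow> int. \<forall>\<theta>\<in>\<Theta>. \<theta> ^ k * ipoly a \<theta> = (\<Sum>l<d. of_int (c l) * \<theta> ^ l)"
  proof
    fix k
    obtain c :: "nat \<Rightarrow> int" where
      "\<And>\<theta>::real. ipoly f \<theta> = 0 \<Longrightarrow> ipoly (monom 1 k * a) \<theta> = (\<Sum>l<degree f. of_int (c l) * \<theta> ^ l)"
      using reduce_at_roots[OF m] by blast
    then show "\<exists>c :: nat \<Rightarrow> int. \<forall>\<theta>\<in>\<Theta>. \<theta> ^ k * ipoly a \<theta> = (\<Sum>l<d. of_int (c l) * \<theta> ^ l)"
      by (intro exI[of _ c]) (simp add: \<Theta>_def d_def of_int_poly_hom.hom_mult poly_monom)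
  qed
  then obtain c :: "nat \<Rightarrow> nat \<Rightarrow> int"
    where c: "\<And>k \<theta>. \<theta> \<in> \<Theta> \<Longrightarrow> \<theta> ^ k * ipoly a \<theta> = (\<Sum>l<d. of_int (c k l) * \<theta> ^ l)"
    by metis
  define A where "A = mat d d (\<lambda>(k, l). c k l)"
  have A: "A \<in> carrier_mat d d" by (simp add: A_def)
  define W where "W = mat d d (\<lambda>(l, i). t i ^ l)"
  define D where "D = mat d d (\<lambda>(i, j). if i = j then ipoly a (t i) else 0)"
  have W: "W \<in> carrier_mat d d" and D: "D \<in> carrier_mat d d" by (simp_all add: W_def D_def)
  let ?A = "map_mat real_of_int A"
  have rA: "?A \<in> carrier_mat d d" using A by simp
  have "?A * W = W * D"
  proof (rule eq_matI)
    fix k i assume "k < dim_row (W * D)" "i < dim_col (W * D)"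
    then have ki: "k < d" "i < d" by (auto simp: W_def D_def)
    then have ti: "t i \<in> \<Theta>" using im by auto
    have "(?A * W) $$ (k, i) = (\<Sum>l<d. of_int (c k l) * t i ^ l)"
      using ki by (auto simp: A_def W_def scalar_prod_def atLeast0LessThan intro!: sum.cong)
    also have "\<dots> = t i ^ k * ipoly a (t i)" using c[OF ti] by simp
    also have "\<dots> = (W * D) $$ (k, i)"
      using ki by (simp add: D_def W_def scalar_prod_def atLeast0LessThan if_distrib cong: if_cong)
    finally show "(?A * W) $$ (k, i) = (W * D) $$ (k, i)" .
  qed (auto simp: A_def W_def D_def)
  then have "det ?A * det W = det W * det D"
    using det_mult[OF rA W] det_mult[OF W D] by metis
  moreover have "det W \<noteq> 0"
    unfolding W_def by (rule det_vandermonde_nonzero[OF inj])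
  ultimately have "det ?A = det D" by (simp del: of_int_hom.hom_det)
  also have "det D = prod_list (diag_mat D)"
    using D by (intro det_upper_triangular) (auto simp: upper_triangular_def D_def)
  also have "\<dots> = (\<Prod>i<d. ipoly a (t i))"
    by (simp add: prod_list_diag_prod D_def atLeast0LessThan)
  also have "\<dots> = (\<Prod>\<theta>\<in>\<Theta>. ipoly a \<theta>)"
    using prod.reindex_bij_betw[OF t, of "ipoly a"] by simp
  finally have N: "real_of_int (det A) = (\<Prod>\<theta>\<in>\<Theta>. ipoly a \<theta>)"
    by (simp add: of_int_hom.hom_det)
  define b where "b = (\<Sum>k<d. monom (adj_mat A $$ (0, k)) k)"
  have b: "ipoly b \<theta> = (\<Sum>k<d. of_int (adj_mat A $$ (0, k)) * \<theta> ^ k)" for \<theta> :: real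
    by (simp add: b_def of_int_poly_hom.hom_sum poly_sum poly_monom)
  have ab: "ipoly a \<theta> * ipoly b \<theta> = of_int (det A)" if \<theta>: "\<theta> \<in> \<Theta>" for \<theta>
  proof -
    have adj: "(\<Sum>k<d. adj_mat A $$ (0, k) * c k l) = (if l = 0 then det A else 0)" if l: "l < d" for l
    proof -
      have "(adj_mat A * A) $$ (0, l) = (\<Sum>k<d. adj_mat A $$ (0, k) * c k l)"
        using adj_mat(1)[OF A] d0 l
        by (auto simp: A_def scalar_prod_def atLeast0LessThan adj_mat_def intro!: sum.cong)
      then show ?thesis using adj_mat(3)[OF A] d0 l by (cases "l = 0") auto
    qed
    have "ipoly a \<theta> * ipoly b \<theta> = (\<Sum>k<d. of_int (adj_mat A $$ (0, k)) * (\<theta> ^ k * ipoly a \<theta>))"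
      by (simp add: b sum_distrib_left mult_ac)
    also have "\<dots> = (\<Sum>k<d. \<Sum>l<d. of_int (adj_mat A $$ (0, k) * c k l) * \<theta> ^ l)"
      by (simp add: c[OF \<theta>] sum_distrib_left mult.assoc)
    also have "\<dots> = (\<Sum>l<d. of_int (\<Sum>k<d. adj_mat A $$ (0, k) * c k l) * \<theta> ^ l)"
      by (subst sum.swap) (simp add: sum_distrib_right)
    also have "\<dots> = (\<Sum>l<d. if l = 0 then of_int (det A) else 0)"
      by (rule sum.cong[OF refl], subst adj) auto
    also have "\<dots> = of_int (det A)" using d0 by simp
    finally show ?thesis .
  qed
  show ?thesis using that[OF N ab] .
qed

section \<open>Dirichlet's construction of units in totally real fields\<close>

text \<open>
  The box principle, in place of Minkowski's theorem on lattice points. The bounds are balanced so that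
  the product of the values over all \<open>d\<close> roots is at most \<open>C\<^sup>d\<close>, whatever \<open>m\<close> is, whereas the
  values at all roots but one become arbitrarily small.
\<close>

lemma pigeonhole_small_values:
  fixes \<Theta> :: "real set"
  assumes card: "card \<Theta> = d" and d: "d > 0" and \<theta>0: "\<theta>0 \<in> \<Theta>"
  obtains C :: real where "C > 0"
    and "\<And>m. m > 0 \<Longrightarrow> \<exists>a :: int poly. a \<noteq> 0 \<and> degree a < d \<and> \<bar>ipoly a \<theta>0\<bar> \<le> C * real m ^ (d - 1) \<and>
           (\<forall>\<theta>\<in>\<Theta> - {\<theta>0}. \<bar>ipoly a \<theta>\<bar> \<le> C / real m)"
proof -
  have fin: "finite \<Theta>" using card d by (metis card.infinite less_irrefl)
  define M where "M = 1 + (\<Sum>\<theta>\<in>\<Theta>. \<Sum>l<d. \<bar>\<theta>\<bar> ^ l)"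
  have M: "M > 0" by (auto simp: M_def intro!: add_pos_nonneg sum_nonneg)
  define val :: "(nat \<Rightarrow> nat) \<Rightarrow> real \<Rightarrow> real" where "val c \<theta> = (\<Sum>l<d. real (c l) * \<theta> ^ l)" for c \<theta>
  have "\<exists>a :: int poly. a \<noteq> 0 \<and> degree a < d \<and> \<bar>ipoly a \<theta>0\<bar> \<le> 2 * M * real m ^ (d - 1) \<and>
           (\<forall>\<theta>\<in>\<Theta> - {\<theta>0}. \<bar>ipoly a \<theta>\<bar> \<le> 2 * M / real m)" if m: "m > 0" for m
  proof -
    \<comment> \<open>There are \<open>(Q + 1)\<^sup>d\<close> polynomials with coefficients from 0 to \<open>Q\<close>. Cutting the range of values at
      each root other than \<open>\<theta>0\<close> into \<open>h\<close> cells makes \<open>h ^ (d - 1) = Q\<^sup>d\<close> boxes, which are fewer.\<close>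
    define Q where "Q = m ^ (d - 1)"
    define h where "h = m ^ d"
    have Q: "Q > 0" and h: "h > 0" using m by (simp_all add: Q_def h_def)
    define F where "F = PiE {..<d} (\<lambda>_. {..Q})"
    define cell where "cell c = restrict (\<lambda>\<theta>. nat \<lfloor>(val c \<theta> + M * Q) * h / (2 * M * Q)\<rfloor>) (\<Theta> - {\<theta>0})" for c
    have val: "\<bar>val c \<theta>\<bar> < M * Q" if c: "c \<in> F" and \<theta>: "\<theta> \<in> \<Theta>" for c \<theta>
    proof -
      have "\<bar>val c \<theta>\<bar> \<le> (\<Sum>l<d. real (c l) * \<bar>\<theta>\<bar> ^ l)"
        unfolding val_def by (rule order_trans[OF sum_abs]) (simp add: abs_mult power_abs)
      also have "\<dots> \<le> (\<Sum>l<d. real Q * \<bar>\<theta>\<bar> ^ l)"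
        using c by (intro sum_mono mult_right_mono) (auto simp: F_def PiE_iff)
      also have "\<dots> = Q * (\<Sum>l<d. \<bar>\<theta>\<bar> ^ l)" by (simp add: sum_distrib_left)
      also have "\<dots> < Q * M"
      proof -
        have "(\<Sum>l<d. \<bar>\<theta>\<bar> ^ l) \<le> (\<Sum>\<theta>\<in>\<Theta>. \<Sum>l<d. \<bar>\<theta>\<bar> ^ l)"
          using fin \<theta> by (intro member_le_sum) (auto intro: sum_nonneg)
        then show ?thesis using Q by (simp add: M_def)
      qed
      finally show ?thesis by (simp add: mult.commute)
    qed
    have bounds: "0 \<le> (val c \<theta> + M * Q) * h / (2 * M * Q) \<and> (val c \<theta> + M * Q) * h / (2 * M * Q) < h"
      if c: "c \<in> F" and \<theta>: "\<theta> \<in> \<Theta>" for c \<theta>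
    proof
      have v: "- (M * Q) < val c \<theta>" "val c \<theta> < M * Q" using val[OF that] by auto
      then show "0 \<le> (val c \<theta> + M * Q) * h / (2 * M * Q)"
        using M by (intro divide_nonneg_nonneg mult_nonneg_nonneg) auto
      have "(val c \<theta> + M * Q) * h < (2 * M * Q) * h"
        using v h by (intro mult_strict_right_mono) auto
      then show "(val c \<theta> + M * Q) * h / (2 * M * Q) < h"
        using M Q by (simp add: pos_divide_less_eq mult.commute)
    qed
    have sub: "cell ` F \<subseteq> PiE (\<Theta> - {\<theta>0}) (\<lambda>_. {..<h})"
    proof
      fix g assume "g \<in> cell ` F"
      then obtain c where c: "c \<in> F" and g: "g = cell c" by auto
      show "g \<in> PiE (\<Theta> - {\<theta>0}) (\<lambda>_. {..<h})"
        unfolding g cell_def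
      proof (rule restrict_PiE_iff[THEN iffD2], rule ballI)
        fix \<theta> assume "\<theta> \<in> \<Theta> - {\<theta>0}"
        then show "nat \<lfloor>(val c \<theta> + M * Q) * h / (2 * M * Q)\<rfloor> \<in> {..<h}"
          using bounds[OF c, of \<theta>] by (auto simp: nat_less_iff floor_less_iff)
      qed
    qed
    have finP: "finite (PiE (\<Theta> - {\<theta>0}) (\<lambda>_. {..<h}))"
      using fin by (intro finite_PiE) auto
    have "card (cell ` F) \<le> card (PiE (\<Theta> - {\<theta>0}) (\<lambda>_. {..<h}))"
      by (rule card_mono[OF finP sub])
    also have "\<dots> = h ^ (d - 1)" using fin \<theta>0 card by (simp add: card_PiE)
    also have "\<dots> = Q ^ d" by (simp add: h_def Q_def power_mult[symmetric] mult.commute)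
    also have "\<dots> < (Suc Q) ^ d" using d by (intro power_strict_mono) auto
    also have "\<dots> = card F" by (simp add: F_def card_PiE)
    finally have "\<not> inj_on cell F" by (rule pigeonhole)
    then obtain c c' where c: "c \<in> F" "c' \<in> F" "c \<noteq> c'" and same: "cell c = cell c'"
      by (auto simp: inj_on_def)
    define a :: "int poly" where "a = (\<Sum>l<d. monom (int (c l) - int (c' l)) l)"
    have coeff: "coeff a l = (if l < d then int (c l) - int (c' l) else 0)" for l
      by (simp add: a_def coeff_sum if_distrib cong: if_cong)
    have a_val: "ipoly a \<theta> = val c \<theta> - val c' \<theta>" for \<theta> :: real
      by (simp add: a_def val_def of_int_poly_hom.hom_sum poly_sum poly_monom algebra_simps sum_subtractf)
    obtain l where l: "l < d" "c l \<noteq> c' l"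
      using c by (auto simp: F_def) (metis PiE_ext lessThan_iff)
    then have a0: "a \<noteq> 0" using coeff[of l] by auto
    then have deg: "degree a < d" using coeff by (metis leading_coeff_0_iff)
    have "\<bar>ipoly a \<theta>\<bar> \<le> 2 * M / real m" if \<theta>: "\<theta> \<in> \<Theta> - {\<theta>0}" for \<theta>
    proof -
      let ?u = "(val c \<theta> + M * Q) * h / (2 * M * Q)" and ?v = "(val c' \<theta> + M * Q) * h / (2 * M * Q)"
      have nn: "0 \<le> ?u" "0 \<le> ?v" using bounds c \<theta> by auto
      have "nat \<lfloor>?u\<rfloor> = nat \<lfloor>?v\<rfloor>"
        using fun_cong[OF same, of \<theta>] \<theta> by (simp add: cell_def)
      then have "\<lfloor>?u\<rfloor> = \<lfloor>?v\<rfloor>" using nn by (simp add: nat_eq_iff)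
      then have "\<bar>?u - ?v\<bar> \<le> 1" by linarith
      moreover have "?u - ?v = ipoly a \<theta> * h / (2 * M * Q)"
        by (simp add: a_val diff_divide_distrib[symmetric] algebra_simps)
      ultimately have "\<bar>ipoly a \<theta>\<bar> * h / (2 * M * Q) \<le> 1"
        using M Q h by (simp add: abs_mult)
      then have "\<bar>ipoly a \<theta>\<bar> * h \<le> 2 * M * Q" using M Q by (simp add: pos_divide_le_eq)
      moreover have "real h = m * Q" using d by (simp add: h_def Q_def power_eq_if)
      ultimately have "\<bar>ipoly a \<theta>\<bar> * m * Q \<le> 2 * M * Q" by (simp add: mult.assoc)
      then have "\<bar>ipoly a \<theta>\<bar> * m \<le> 2 * M" using Q by simp
      then show ?thesis using m by (simp add: pos_le_divide_eq)
    qed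
    moreover have "\<bar>ipoly a \<theta>0\<bar> \<le> 2 * M * real m ^ (d - 1)"
      using val[OF c(1) \<theta>0] val[OF c(2) \<theta>0] by (simp add: a_val Q_def)
    ultimately show ?thesis using a0 deg by blast
  qed
  then show ?thesis using that[of "2 * M"] M by simp
qed

text \<open>
  Dirichlet's argument: among infinitely many elements of bounded norm, with smaller and smaller values at
  one root, two elements \<open>a\<close> and \<open>a'\<close> have the same norm \<open>N\<close> and are congruent modulo \<open>N r\<close>.
  As \<open>N\<close> is a multiple of \<open>a\<close> and of \<open>a'\<close>, the quotient \<open>a' / a = 1 + (a' - a) / a\<close> and its inverse
  are integral, and both are congruent to 1 modulo \<open>r\<close>. The factor \<open>r\<close> is there for lifting the unit
  from the field generated by one root to products of several fields.
\<close>

lemma unit_at_conjugates: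
  fixes f :: "int poly" and r :: int
  defines "\<Theta> \<equiv> {x::real. ipoly f x = 0}"
  assumes f: "irreducible f" and m: "lead_coeff f = 1" and d: "degree f \<ge> 2" and tr: "totally_real f"
    and r: "r \<noteq> 0"
  obtains w w' :: "int poly"
  where "\<And>\<theta>. \<theta> \<in> \<Theta> \<Longrightarrow> (1 + of_int r * ipoly w \<theta>) * (1 + of_int r * ipoly w' \<theta>) = 1"
    and "\<exists>\<theta>\<in>\<Theta>. (1 + of_int r * ipoly w \<theta>)\<^sup>2 \<noteq> 1"
proof -
  define d where "d = degree f"
  have d2: "d \<ge> 2" using d by (simp add: d_def)
  have fin: "finite \<Theta>" and card: "card \<Theta> = d"
    using card_real_roots_irreducible[OF f _ tr] d by (auto simp: \<Theta>_def d_def)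
  then obtain \<theta>0 \<theta>2 where \<theta>: "\<theta>0 \<in> \<Theta>" "\<theta>2 \<in> \<Theta>" "\<theta>0 \<noteq> \<theta>2"
    using d2 by (metis card_le_Suc0_iff_eq One_nat_def not_less_eq_eq numeral_2_eq_2)
  have nonzero: "ipoly a \<theta> \<noteq> 0" if "a \<noteq> 0" "degree a < d" "\<theta> \<in> \<Theta>" for a \<theta>
  proof
    assume "ipoly a \<theta> = 0"
    then have "f dvd a"
      using common_root_imp_dvd[OF f, of "complex_of_real \<theta>" a] that by (simp add: ipoly_of_real \<Theta>_def)
    then show False using that dvd_imp_degree_le[of f a] by (simp add: d_def)
  qed
  obtain C :: real where C: "C > 0"
    and small: "\<And>m. m > 0 \<Longrightarrow> \<exists>a :: int poly. a \<noteq> 0 \<and> degree a < d \<and> \<bar>ipoly a \<theta>0\<bar> \<le> C * real m ^ (d - 1) \<and>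
           (\<forall>\<theta>\<in>\<Theta> - {\<theta>0}. \<bar>ipoly a \<theta>\<bar> \<le> C / real m)"
    using pigeonhole_small_values[OF card _ \<theta>(1)] d2 by auto
  have "\<forall>a. \<exists>N b. of_int N = (\<Prod>\<theta>\<in>\<Theta>. ipoly a \<theta>) \<and> (\<forall>\<theta>\<in>\<Theta>. ipoly a \<theta> * ipoly b \<theta> = of_int N)"
  proof
    fix a
    obtain N :: int and b :: "int poly" where "of_int N = (\<Prod>\<theta>\<in>\<Theta>. ipoly a \<theta>)"
      "\<And>\<theta>. \<theta> \<in> \<Theta> \<Longrightarrow> ipoly a \<theta> * ipoly b \<theta> = of_int N"
      using norm_of_polynomial_value[OF m, of a] d card unfolding d_def \<Theta>_def by auto
    then show "\<exists>N b. of_int N = (\<Prod>\<theta>\<in>\<Theta>. ipoly a \<theta>) \<and> (\<forall>\<theta>\<in>\<Theta>. ipoly a \<theta> * ipoly b \<theta> = of_int N)"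
      by blast
  qed
  then obtain N :: "int poly \<Rightarrow> int" and cof :: "int poly \<Rightarrow> int poly"
    where N: "\<And>a. of_int (N a) = (\<Prod>\<theta>\<in>\<Theta>. ipoly a \<theta>)"
      and cof: "\<And>a \<theta>. \<theta> \<in> \<Theta> \<Longrightarrow> ipoly a \<theta> * ipoly (cof a) \<theta> = of_int (N a)"
    by metis
  define B where "B = \<lceil>C ^ d\<rceil>"
  define A where "A = {a. a \<noteq> 0 \<and> degree a < d \<and> \<bar>N a\<bar> \<le> B}"
  have arbitrarily_small: "\<exists>a\<in>A. \<bar>ipoly a \<theta>2\<bar> < \<eta>" if \<eta>: "\<eta> > 0" for \<eta> :: real
  proof -
    define k where "k = Suc (nat \<lceil>C / \<eta>\<rceil>)"
    have k: "k > 0" "C / \<eta> < k" unfolding k_def by linarith+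
    obtain a :: "int poly" where a: "a \<noteq> 0" "degree a < d" "\<bar>ipoly a \<theta>0\<bar> \<le> C * real k ^ (d - 1)"
      and a': "\<And>\<theta>. \<theta> \<in> \<Theta> - {\<theta>0} \<Longrightarrow> \<bar>ipoly a \<theta>\<bar> \<le> C / real k" using small[OF k(1)] by blast
    have "\<bar>real_of_int (N a)\<bar> = \<bar>ipoly a \<theta>0\<bar> * (\<Prod>\<theta>\<in>\<Theta> - {\<theta>0}. \<bar>ipoly a \<theta>\<bar>)"
      unfolding N abs_prod using fin \<theta>(1) by (subst prod.remove[of _ \<theta>0]) auto
    also have "\<dots> \<le> (C * real k ^ (d - 1)) * (\<Prod>\<theta>\<in>\<Theta> - {\<theta>0}. C / real k)"
      using a a' C by (intro mult_mono prod_mono prod_nonneg) auto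
    also have "\<dots> = C * (real k * (C / real k)) ^ (d - 1)"
      using \<theta>(1) card fin by (subst power_mult_distrib) (simp add: mult.assoc)
    also have "\<dots> = C ^ d" using k d2 by (simp add: power_eq_if)
    finally have "\<bar>N a\<bar> \<le> B" unfolding B_def by linarith
    moreover have "\<bar>ipoly a \<theta>2\<bar> < \<eta>"
    proof -
      have "\<bar>ipoly a \<theta>2\<bar> \<le> C / k" using a' \<theta> by auto
      also have "\<dots> < \<eta>" using k \<eta> by (simp add: field_simps)
      finally show ?thesis .
    qed
    ultimately show ?thesis using a by (auto simp: A_def)
  qed
  define V where "V = (\<lambda>a. \<bar>ipoly a \<theta>2\<bar>) ` A"
  have Vpos: "v > 0" if "v \<in> V" for v
    using that nonzero \<theta>(2) by (auto simp: V_def A_def)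
  have infV: "infinite V"
  proof
    assume finV: "finite V"
    have "V \<noteq> {}" using arbitrarily_small[of 1] by (auto simp: V_def)
    with finV Vpos have "Min V > 0" by simp
    with arbitrarily_small[of "Min V"] obtain v where "v \<in> V" "v < Min V" by (auto simp: V_def)
    with finV show False by (metis Min_le not_le)
  qed
  have "\<forall>v\<in>V. \<exists>a. a \<in> A \<and> \<bar>ipoly a \<theta>2\<bar> = v" by (auto simp: V_def)
  then obtain pick where pick: "\<And>v. v \<in> V \<Longrightarrow> pick v \<in> A \<and> \<bar>ipoly (pick v) \<theta>2\<bar> = v"
    by metis
  have N0: "N a \<noteq> 0" if "a \<in> A" for a
  proof -
    have "real_of_int (N a) \<noteq> 0" using nonzero that fin by (auto simp: N A_def)
    then show ?thesis by simp
  qed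
  \<comment> \<open>Two elements of \<open>A\<close> that agree here have an integral quotient.\<close>
  define cls where "cls a = (N a, map (\<lambda>l. coeff a l mod (N a * r)) [0..<d])" for a
  define R where "R = B * \<bar>r\<bar>"
  have "(cls \<circ> pick) ` V \<subseteq> {-B..B} \<times> {xs. set xs \<subseteq> {-R..R} \<and> length xs = d}"
  proof
    fix y assume "y \<in> (cls \<circ> pick) ` V"
    then obtain a where a: "a \<in> A" and y: "y = cls a" using pick by auto
    have "\<bar>N a * r\<bar> \<le> R" using a by (auto simp: A_def R_def abs_mult intro: mult_right_mono)
    moreover have "N a * r \<noteq> 0" using N0[OF a] r by simp
    ultimately have "x mod (N a * r) \<in> {-R..R}" for x
      using abs_mod_less[of "N a * r" x] by auto
    then show "y \<in> {-B..B} \<times> {xs. set xs \<subseteq> {-R..R} \<and> length xs = d}"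
      using a by (auto simp: y cls_def A_def)
  qed
  then have "finite ((cls \<circ> pick) ` V)"
    by (rule finite_subset) (intro finite_cartesian_product finite_lists_length_eq; simp)
  then have "\<not> inj_on (cls \<circ> pick) V" using infV finite_image_iff by blast
  then obtain v v' where v: "v \<in> V" "v' \<in> V" "v \<noteq> v'" and same: "cls (pick v) = cls (pick v')"
    by (auto simp: inj_on_def)
  define a a' where "a = pick v" and "a' = pick v'"
  have aA: "a \<in> A" "a' \<in> A" and av: "\<bar>ipoly a \<theta>2\<bar> \<noteq> \<bar>ipoly a' \<theta>2\<bar>"
    using pick[OF v(1)] pick[OF v(2)] v(3) by (auto simp: a_def a'_def)
  have Neq: "N a' = N a" using same by (simp add: cls_def a_def a'_def)
  have cong: "coeff a l mod (N a * r) = coeff a' l mod (N a * r)" for l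
  proof (cases "l < d")
    case True
    with same show ?thesis by (auto simp: cls_def a_def a'_def)
  next
    case False
    with aA show ?thesis by (simp add: A_def coeff_eq_0)
  qed
  have "[:N a * r:] dvd a - a'"
    using cong by (auto simp: const_poly_dvd_iff mod_eq_dvd_iff)
  then obtain s where s: "a - a' = [:N a * r:] * s" by (auto simp: dvd_def)
  have a_nz: "ipoly a \<theta> \<noteq> 0" "ipoly a' \<theta> \<noteq> 0" if "\<theta> \<in> \<Theta>" for \<theta>
    using nonzero aA that by (auto simp: A_def)
  have diff: "ipoly a \<theta> - ipoly a' \<theta> = of_int (N a) * of_int r * ipoly s \<theta>" for \<theta> :: real
  proof -
    have "ipoly a \<theta> - ipoly a' \<theta> = ipoly (a - a') \<theta>" by (simp add: of_int_poly_hom.hom_minus)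
    then show ?thesis by (simp add: s ipoly_smult)
  qed
  define w w' where "w = - (s * cof a)" and "w' = s * cof a'"
  have q1: "1 + of_int r * ipoly w \<theta> = ipoly a' \<theta> / ipoly a \<theta>" if t: "\<theta> \<in> \<Theta>" for \<theta>
  proof -
    have "ipoly a \<theta> * (1 + of_int r * ipoly w \<theta>)
      = ipoly a \<theta> - of_int r * ipoly s \<theta> * (ipoly a \<theta> * ipoly (cof a) \<theta>)"
      by (simp add: w_def of_int_poly_hom.hom_uminus of_int_poly_hom.hom_mult algebra_simps)
    also have "\<dots> = ipoly a \<theta> - (ipoly a \<theta> - ipoly a' \<theta>)"
      unfolding cof[OF t] diff by (simp add: mult_ac)
    also have "\<dots> = ipoly a' \<theta>" by simp
    finally show ?thesis using a_nz[OF t] by (simp add: field_simps)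
  qed
  have q2: "1 + of_int r * ipoly w' \<theta> = ipoly a \<theta> / ipoly a' \<theta>" if t: "\<theta> \<in> \<Theta>" for \<theta>
  proof -
    have "ipoly a' \<theta> * (1 + of_int r * ipoly w' \<theta>)
      = ipoly a' \<theta> + of_int r * ipoly s \<theta> * (ipoly a' \<theta> * ipoly (cof a') \<theta>)"
      by (simp add: w'_def of_int_poly_hom.hom_mult algebra_simps)
    also have "\<dots> = ipoly a' \<theta> + (ipoly a \<theta> - ipoly a' \<theta>)"
      unfolding cof[OF t] diff Neq by (simp add: mult_ac)
    also have "\<dots> = ipoly a \<theta>" by simp
    finally show ?thesis using a_nz[OF t] by (simp add: field_simps)
  qed
  show ?thesis
  proof (rule that[of w w'])
    fix \<theta> assume "\<theta> \<in> \<Theta>"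
    then show "(1 + of_int r * ipoly w \<theta>) * (1 + of_int r * ipoly w' \<theta>) = 1"
      using a_nz by (simp add: q1 q2)
  next
    have "(ipoly a' \<theta>2 / ipoly a \<theta>2)\<^sup>2 \<noteq> 1"
      using av a_nz[OF \<theta>(2)] by (simp add: power_divide divide_eq_eq abs_eq_iff power2_eq_iff)
    then show "\<exists>\<theta>\<in>\<Theta>. (1 + of_int r * ipoly w \<theta>)\<^sup>2 \<noteq> 1" using \<theta>(2) q1 by metis
  qed
qed

lemma ipoly_root_factor:
  fixes f :: "int poly" and \<theta> :: real
  assumes f: "lead_coeff f = 1" and root: "ipoly f \<theta> = 0"
  obtains p where "irreducible p" "lead_coeff p = 1" "p dvd f" "ipoly p \<theta> = 0"
proof -
  have f0: "f \<noteq> 0" using f by auto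
  have "f dvd prod_mset (prime_factorization f)" using f0
    by (metis prod_mset_prime_factorization_weak dvd_normalize_iff dvd_refl)
  then have "ipoly (prod_mset (prime_factorization f)) \<theta> = 0"
    using root by (auto simp: dvd_def of_int_poly_hom.hom_mult)
  moreover have "\<exists>p\<in>#X. ipoly p \<theta> = 0" if "ipoly (prod_mset X) \<theta> = 0" for X :: "int poly multiset"
    using that by (induction X) (auto simp: of_int_poly_hom.hom_mult)
  ultimately obtain p where p: "p \<in># prime_factorization f" "ipoly p \<theta> = 0" by blast
  then have irr: "irreducible p" and pf: "p dvd f"
    by (auto simp: in_prime_factors_iff prime_imp_prime_elem intro: prime_elem_imp_irreducible)
  define u where "u = lead_coeff p"
  have "u dvd 1" using pf f unfolding u_def by (metis dvd_def lead_coeff_mult)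
  then have "u = 1 \<or> u = - 1" by (simp add: zdvd1_eq) linarith
  then have u: "u * u = 1" by auto
  then have "[:u:] * [:u:] = 1" by simp
  then have unit: "[:u:] dvd 1" by (metis dvd_triv_left)
  show ?thesis
  proof (rule that[of "[:u:] * p"])
    show "irreducible ([:u:] * p)" using irr irreducible_mult_unit_left[OF unit] by blast
    show "lead_coeff ([:u:] * p) = 1" using u by (simp only: lead_coeff_mult) (simp add: u_def)
    show "[:u:] * p dvd f" using pf mult_unit_dvd_iff'[OF unit] by blast
    show "ipoly ([:u:] * p) \<theta> = 0" using p by (simp add: of_int_poly_hom.hom_mult del: mult_pCons_left)
  qed
qed

text \<open>
  Let \<open>p\<close> be the irreducible factor of \<open>f\<close> with root \<open>\<theta>\<close>, and \<open>f = p\<^sup>k g\<close> with \<open>g\<close> prime to \<open>p\<close>.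
  The norm \<open>r\<close> of \<open>g\<close> modulo \<open>p\<close> is \<open>b g\<close> at the roots of \<open>p\<close>. So \<open>1 + w b g\<close> equals \<open>1 + r w\<close> at
  the roots of \<open>p\<close> and 1 at those of \<open>g\<close>, which extends the unit found for \<open>p\<close> by 1.
\<close>

theorem integer_roots_or_unit:
  fixes f :: "int poly"
  assumes m: "lead_coeff f = 1" and tr: "totally_real f" and \<theta>: "ipoly f (\<theta>::real) = 0" "\<theta> \<notin> \<int>"
  obtains P Q :: "int poly"
  where "\<And>x::real. ipoly f x = 0 \<Longrightarrow> ipoly P x * ipoly Q x = 1"
    and "\<exists>x::real. ipoly f x = 0 \<and> (ipoly P x)\<^sup>2 \<noteq> 1"
proof -
  obtain p where p: "irreducible p" "lead_coeff p = 1" "p dvd f" "ipoly p \<theta> = 0"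
    using ipoly_root_factor[OF m \<theta>(1)] .
  have f0: "f \<noteq> 0" using m by auto
  have deg: "degree p \<ge> 2"
  proof (rule ccontr)
    assume "\<not> degree p \<ge> 2"
    then have "degree p = 0 \<or> degree p = 1" by auto
    then show False
    proof
      assume "degree p = 0"
      then obtain c where "p = [:c:]" by (rule degree_eq_zeroE)
      with p show False by auto
    next
      assume "degree p = 1"
      then obtain c e where pc: "p = [:c, e:]" using degree1_coeffs by blast
      with p \<open>degree p = 1\<close> have "e = 1" by simp
      with pc p(4) have "\<theta> = of_int (- c)" by simp
      with \<theta>(2) show False using Ints_of_int by blast
    qed
  qed
  have trp: "totally_real p" using tr p(3) unfolding totally_real_def
    by (auto simp: dvd_def of_int_poly_hom.hom_mult)
  have "\<not> is_unit p" using p(1) by (simp add: irreducible_def)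
  with f0 obtain g where g: "f = p ^ multiplicity p f * g" "\<not> p dvd g"
    using multiplicity_decompose'[of f p] by metis
  let ?\<Theta> = "{x::real. ipoly p x = 0}"
  have card: "card ?\<Theta> = degree p" and fin: "finite ?\<Theta>"
    using card_real_roots_irreducible[OF p(1) _ trp] deg by auto
  obtain r :: int and b :: "int poly" where r: "of_int r = (\<Prod>x\<in>?\<Theta>. ipoly g x)"
    and b: "\<And>x. x \<in> ?\<Theta> \<Longrightarrow> ipoly g x * ipoly b x = of_int r"
    using norm_of_polynomial_value[OF p(2) _ card, of g] deg by auto
  have "ipoly g x \<noteq> 0" if "x \<in> ?\<Theta>" for x
    using common_root_imp_dvd[OF p(1), of "complex_of_real x" g] that g(2) by (auto simp: ipoly_of_real)
  with fin r have "real_of_int r \<noteq> 0" by simp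
  then have r0: "r \<noteq> 0" by simp
  obtain w w' :: "int poly"
    where w: "\<And>x. x \<in> ?\<Theta> \<Longrightarrow> (1 + of_int r * ipoly w x) * (1 + of_int r * ipoly w' x) = 1"
      and nt: "\<exists>x\<in>?\<Theta>. (1 + of_int r * ipoly w x)\<^sup>2 \<noteq> 1"
    using unit_at_conjugates[OF p(1,2) deg trp r0] by blast
  have on: "ipoly (1 + v * b * g) x = 1 + of_int r * ipoly v x" if "x \<in> ?\<Theta>" for v x
    using b[OF that] by (simp add: of_int_poly_hom.hom_mult of_int_poly_hom.hom_add mult_ac)
  have off: "ipoly (1 + v * b * g) x = 1" if "ipoly g x = 0" for v and x :: real
    using that by (simp add: of_int_poly_hom.hom_mult of_int_poly_hom.hom_add)
  have pf: "ipoly f x = 0" if "x \<in> ?\<Theta>" for x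
    using that p(3) by (auto simp: dvd_def of_int_poly_hom.hom_mult)
  show ?thesis
  proof (rule that[of "1 + w * b * g" "1 + w' * b * g"])
    fix x :: real assume fx: "ipoly f x = 0"
    show "ipoly (1 + w * b * g) x * ipoly (1 + w' * b * g) x = 1"
    proof (cases "x \<in> ?\<Theta>")
      case True
      then show ?thesis unfolding on[OF True] by (rule w)
    next
      case False
      have "ipoly p x ^ multiplicity p f * ipoly g x = 0"
        using fx by (subst (asm) g(1)) (simp add: of_int_poly_hom.hom_mult of_int_poly_hom.hom_power)
      with False have "ipoly g x = 0" by auto
      then show ?thesis by (simp only: off mult_1)
    qed
  next
    show "\<exists>x::real. ipoly f x = 0 \<and> (ipoly (1 + w * b * g) x)\<^sup>2 \<noteq> 1"
    proof -
      obtain x where x: "x \<in> ?\<Theta>" "(1 + of_int r * ipoly w x)\<^sup>2 \<noteq> 1" using nt by blast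
      then show ?thesis using pf[OF x(1)] on[OF x(1), of w] by (intro exI[of _ x]) simp
    qed
  qed
qed

section \<open>Polynomials in symmetric integer matrices\<close>

definition mat_poly :: "'a::comm_ring_1 poly \<Rightarrow> 'a mat \<Rightarrow> 'a mat" where
  "mat_poly P A = fold_coeffs (\<lambda>a B. a \<cdot>\<^sub>m 1\<^sub>m (dim_row A) + A * B) P (0\<^sub>m (dim_row A) (dim_row A))"

lemma mat_poly_0: "A \<in> carrier_mat n n \<Longrightarrow> mat_poly 0 A = 0\<^sub>m n n"
  by (auto simp: mat_poly_def)

lemma mat_poly_pCons:
  "A \<in> carrier_mat n n \<Longrightarrow> mat_poly (pCons a P) A = a \<cdot>\<^sub>m 1\<^sub>m n + A * mat_poly P A"
  by (cases "P = 0 \<and> a = 0") (auto simp: mat_poly_def)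

lemma mat_poly_carrier [simp]: "A \<in> carrier_mat n n \<Longrightarrow> mat_poly P A \<in> carrier_mat n n"
  by (induction P) (auto simp: mat_poly_0 mat_poly_pCons)

lemma mat_poly_dim [simp]:
  "A \<in> carrier_mat n n \<Longrightarrow> dim_row (mat_poly P A) = n"
  "A \<in> carrier_mat n n \<Longrightarrow> dim_col (mat_poly P A) = n"
  using mat_poly_carrier by blast+

lemma mat_poly_const: "A \<in> carrier_mat n n \<Longrightarrow> mat_poly [:a:] A = a \<cdot>\<^sub>m 1\<^sub>m n"
  by (simp add: mat_poly_pCons mat_poly_0)

lemma mat_poly_1: "A \<in> carrier_mat n n \<Longrightarrow> mat_poly 1 A = 1\<^sub>m n"
  unfolding one_pCons by (subst mat_poly_const) auto

lemma mat_poly_X: "A \<in> carrier_mat n n \<Longrightarrow> mat_poly [:0, 1:] A = A"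
  by (auto simp: mat_poly_pCons mat_poly_1 intro!: eq_matI)

lemma mat_poly_add:
  assumes A: "A \<in> carrier_mat n n"
  shows "mat_poly (P + Q) A = mat_poly P A + mat_poly Q A"
proof (induction P Q rule: poly_induct2)
  case (pCons a p b q)
  let ?P = "mat_poly p A" and ?Q = "mat_poly q A"
  have PQ: "?P \<in> carrier_mat n n" "?Q \<in> carrier_mat n n" using A by simp_all
  have "mat_poly (pCons a p + pCons b q) A = (a + b) \<cdot>\<^sub>m 1\<^sub>m n + (A * ?P + A * ?Q)"
    by (simp add: mat_poly_pCons[OF A] pCons.IH mult_add_distrib_mat[OF A PQ])
  also have "\<dots> = mat_poly (pCons a p) A + mat_poly (pCons b q) A" using A PQ
    by (intro eq_matI) (auto simp: mat_poly_pCons[OF A] algebra_simps simp del: index_mult_mat(1))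
  finally show ?case .
qed (use A in \<open>simp add: mat_poly_0\<close>)

lemma mat_poly_smult:
  assumes A: "A \<in> carrier_mat n n"
  shows "mat_poly (smult c P) A = c \<cdot>\<^sub>m mat_poly P A"
proof (induction P)
  case (pCons a p)
  let ?P = "mat_poly p A"
  have P: "?P \<in> carrier_mat n n" using A by simp
  have "mat_poly (smult c (pCons a p)) A = (c * a) \<cdot>\<^sub>m 1\<^sub>m n + c \<cdot>\<^sub>m (A * ?P)"
    by (simp add: mat_poly_pCons[OF A] pCons.IH mult_smult_distrib[OF A P])
  also have "\<dots> = c \<cdot>\<^sub>m mat_poly (pCons a p) A" using A P
    by (intro eq_matI) (auto simp: mat_poly_pCons[OF A] algebra_simps simp del: index_mult_mat(1))
  finally show ?case .
qed (use A in \<open>simp add: mat_poly_0\<close>)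

lemma mat_poly_mult:
  assumes A: "A \<in> carrier_mat n n"
  shows "mat_poly (P * Q) A = mat_poly P A * mat_poly Q A"
proof (induction P)
  case (pCons a p)
  let ?P = "mat_poly p A" and ?Q = "mat_poly Q A"
  have PQ: "?P \<in> carrier_mat n n" "?Q \<in> carrier_mat n n" using A by simp_all
  have APQ: "A * ?P \<in> carrier_mat n n" using A PQ by simp
  have "(a \<cdot>\<^sub>m 1\<^sub>m n + A * ?P) * ?Q = a \<cdot>\<^sub>m ?Q + A * (?P * ?Q)"
    using add_mult_distrib_mat[OF _ APQ PQ(2), of "a \<cdot>\<^sub>m 1\<^sub>m n"] assoc_mult_mat[OF A PQ]
      mult_smult_assoc_mat[of "1\<^sub>m n" n n ?Q n a] PQ by simp
  moreover have "0 \<cdot>\<^sub>m 1\<^sub>m n + A * (?P * ?Q) = A * (?P * ?Q)"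
    using A PQ by (intro eq_matI) (auto simp del: index_mult_mat(1))
  ultimately show ?case using A PQ
    by (simp add: mat_poly_pCons[OF A] mat_poly_add[OF A] mat_poly_smult[OF A] pCons.IH)
qed (use A in \<open>simp add: mat_poly_0\<close>)

lemma mat_poly_sum_index:
  assumes A: "A \<in> carrier_mat n n" and ij: "i < n" "j < n"
  shows "mat_poly (\<Sum>g\<in>S. p g) A $$ (i, j) = (\<Sum>g\<in>S. mat_poly (p g) A $$ (i, j))"
proof -
  have [simp]: "dim_row A = n" "dim_col A = n" using A by auto
  show ?thesis
    by (induction S rule: infinite_finite_induct)
      (use A ij in \<open>simp_all add: mat_poly_0[OF A] mat_poly_add[OF A]\<close>)
qed

lemma mat_poly_transpose:
  assumes A: "A \<in> carrier_mat n n" and sym: "transpose_mat A = A"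
  shows "transpose_mat (mat_poly P A) = mat_poly P A"
proof (induction P)
  case (pCons a p)
  let ?P = "mat_poly p A"
  have P: "?P \<in> carrier_mat n n" using A by simp
  have "A * ?P = mat_poly ([:0, 1:] * p) A" by (simp only: mat_poly_mult[OF A] mat_poly_X[OF A])
  also have "\<dots> = ?P * A" by (simp only: mult.commute[of _ p] mat_poly_mult[OF A] mat_poly_X[OF A])
  finally have "transpose_mat (A * ?P) = A * ?P"
    using transpose_mult[OF A P] sym pCons.IH by simp
  moreover have "transpose_mat (a \<cdot>\<^sub>m 1\<^sub>m n) = a \<cdot>\<^sub>m 1\<^sub>m n" by (rule eq_matI) auto
  ultimately show ?case using A P
    by (simp add: mat_poly_pCons[OF A] transpose_add[of _ n n])
qed (use A in \<open>simp add: mat_poly_0\<close>)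

lemma mat_poly_of_int:
  assumes A: "A \<in> carrier_mat n n"
  shows "map_mat (of_int :: int \<Rightarrow> 'a::comm_ring_1) (mat_poly P A) = mat_poly (of_int_poly P) (map_mat of_int A)"
proof (induction P)
  case (pCons a p)
  let ?P = "mat_poly p A"
  have P: "?P \<in> carrier_mat n n" using A by simp
  let ?h = "map_mat (of_int :: int \<Rightarrow> 'a)"
  have A': "?h A \<in> carrier_mat n n" using A by simp
  have "?h (mat_poly (pCons a p) A) = of_int a \<cdot>\<^sub>m 1\<^sub>m n + ?h (A * ?P)"
    using A P by (intro eq_matI) (auto simp: mat_poly_pCons[OF A] simp del: index_mult_mat(1))
  also have "\<dots> = mat_poly (of_int_poly (pCons a p)) (?h A)"
    by (simp add: mat_poly_pCons[OF A'] of_int_hom.map_poly_pCons_hom pCons.IH[symmetric] of_int_hom.mat_hom_mult[OF A P])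
  finally show ?case .
qed (use A in \<open>auto simp add: mat_poly_0[of _ n] intro!: eq_matI\<close>)

lemma zero_mult_mat_vec: "v \<in> carrier_vec n \<Longrightarrow> 0\<^sub>m n n *\<^sub>v v = 0\<^sub>v n"
  by (intro eq_vecI) auto

lemma mat_poly_eigenvector:
  fixes A :: "'a::field mat"
  assumes A: "A \<in> carrier_mat n n" and v: "v \<in> carrier_vec n" and Av: "A *\<^sub>v v = x \<cdot>\<^sub>v v"
  shows "mat_poly P A *\<^sub>v v = poly P x \<cdot>\<^sub>v v"
proof (induction P)
  case (pCons a p)
  let ?P = "mat_poly p A"
  have P: "?P \<in> carrier_mat n n" using A by simp
  have "(a \<cdot>\<^sub>m 1\<^sub>m n) *\<^sub>v v = a \<cdot>\<^sub>v v"
    using v by (intro eq_vecI) (auto simp: smult_scalar_prod_distrib[of _ n])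
  then have "(a \<cdot>\<^sub>m 1\<^sub>m n + A * ?P) *\<^sub>v v = a \<cdot>\<^sub>v v + A *\<^sub>v (?P *\<^sub>v v)"
    using A P v by (simp add: add_mult_distrib_mat_vec[of _ n n] assoc_mult_mat_vec[of _ n n _ n])
  also have "\<dots> = (a + x * poly p x) \<cdot>\<^sub>v v"
    using v A by (simp add: pCons.IH mult_mat_vec[OF A v] Av smult_smult_assoc add_smult_distrib_vec mult.commute)
  finally show ?case by (simp add: mat_poly_pCons[OF A])
qed (use A v in \<open>auto simp add: mat_poly_0\<close>)

text \<open>
  With \<open>M = X I - A\<close>, the identity \<open>adj(M) M = det(M) I\<close> has polynomials as entries. Replace \<open>X\<close>
  by \<open>A\<close> in the entry at \<open>(h, k)\<close>, apply it to the \<open>k\<close>-th standard basis vector \<open>e\<^sub>k\<close>, and sum over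
  \<open>k\<close>: the right-hand side becomes the characteristic polynomial of \<open>A\<close> at \<open>A\<close>, applied to \<open>e\<^sub>h\<close>.
  The left-hand side vanishes, as \<open>\<Sum>k. M\<^sub>g\<^sub>k(A) e\<^sub>k = A e\<^sub>g - (\<Sum>k. A\<^sub>g\<^sub>k e\<^sub>k)\<close>, and this is 0 by
  the symmetry of \<open>A\<close>.
\<close>

theorem cayley_hamilton_symmetric:
  assumes A: "A \<in> carrier_mat n n" and sym: "transpose_mat A = A"
  shows "mat_poly (char_poly A) A = 0\<^sub>m n n"
proof (rule eq_matI)
  define M where "M = char_poly_matrix A"
  have M: "M \<in> carrier_mat n n" using A by (simp add: M_def)
  have [simp]: "dim_row A = n" "dim_col A = n" using A by auto
  have symA: "A $$ (i, j) = A $$ (j, i)" if "i < n" "j < n" for i j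
    using sym that by (metis A carrier_matD index_transpose_mat(1))
  have entry: "M $$ (g, k) = (if g = k then [:0, 1:] else 0) + [:- (A $$ (g, k)):]" if "g < n" "k < n" for g k
    using that by (auto simp: M_def char_poly_matrix_def)
  define B where "B = adj_mat M"
  have B: "B \<in> carrier_mat n n" and BM: "B * M = char_poly A \<cdot>\<^sub>m 1\<^sub>m n"
    using adj_mat[OF M] by (simp_all add: B_def M_def char_poly_def)
  fix i h assume "i < dim_row (0\<^sub>m n n)" "h < dim_col (0\<^sub>m n n)"
  then have i: "i < n" and h: "h < n" by auto
  have row: "(\<Sum>k<n. mat_poly (M $$ (g, k)) A $$ (j, k)) = 0" if g: "g < n" and j: "j < n" for g j
  proof -
    have "mat_poly (M $$ (g, k)) A $$ (j, k) = (if g = k then A $$ (j, k) else 0) - (if j = k then A $$ (g, k) else 0)"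
      if k: "k < n" for k
    proof -
      have "mat_poly (M $$ (g, k)) A $$ (j, k)
          = mat_poly (if g = k then [:0, 1:] else 0) A $$ (j, k) + mat_poly [:- (A $$ (g, k)):] A $$ (j, k)"
        unfolding entry[OF g k] mat_poly_add[OF A] by (rule index_add_mat(1)) (use A j k in simp_all)
      moreover have "mat_poly [:- (A $$ (g, k)):] A $$ (j, k) = (if j = k then - (A $$ (g, k)) else 0)"
        unfolding mat_poly_const[OF A] using j k by simp
      moreover have "mat_poly (if g = k then [:0, 1:] else 0) A $$ (j, k) = (if g = k then A $$ (j, k) else 0)"
        using j k by (simp only: mat_poly_X[OF A] mat_poly_0[OF A] index_zero_mat split: if_split) simp
      ultimately show ?thesis by simp
    qed
    then have "(\<Sum>k<n. mat_poly (M $$ (g, k)) A $$ (j, k))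
      = (\<Sum>k<n. (if g = k then A $$ (j, k) else 0) - (if j = k then A $$ (g, k) else 0))" by simp
    also have "\<dots> = 0" using g j symA[OF g j] by (simp add: sum_subtractf)
    finally show ?thesis .
  qed
  have "mat_poly (char_poly A) A $$ (i, h) = (\<Sum>k<n. mat_poly ((B * M) $$ (h, k)) A $$ (i, k))"
  proof -
    have "mat_poly ((B * M) $$ (h, k)) A $$ (i, k) = (if h = k then mat_poly (char_poly A) A $$ (i, k) else 0)"
      if "k < n" for k
      using that i h by (auto simp: BM mat_poly_0[OF A])
    then show ?thesis using h by simp
  qed
  also have "\<dots> = (\<Sum>k<n. \<Sum>g<n. \<Sum>j<n. mat_poly (B $$ (h, g)) A $$ (i, j) * mat_poly (M $$ (g, k)) A $$ (j, k))"
  proof (rule sum.cong[OF refl])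
    fix k assume "k \<in> {..<n}"
    then have k: "k < n" by simp
    have "(B * M) $$ (h, k) = (\<Sum>g<n. B $$ (h, g) * M $$ (g, k))"
      using B M h k by (auto simp: scalar_prod_def atLeast0LessThan intro!: sum.cong)
    moreover have "(mat_poly p A * mat_poly q A) $$ (i, k) = (\<Sum>j<n. mat_poly p A $$ (i, j) * mat_poly q A $$ (j, k))" for p q
      using A i k by (auto simp: scalar_prod_def atLeast0LessThan intro!: sum.cong)
    ultimately show "mat_poly ((B * M) $$ (h, k)) A $$ (i, k)
      = (\<Sum>g<n. \<Sum>j<n. mat_poly (B $$ (h, g)) A $$ (i, j) * mat_poly (M $$ (g, k)) A $$ (j, k))"
      using i k by (simp add: mat_poly_sum_index[OF A] mat_poly_mult[OF A] del: index_mult_mat)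
  qed
  also have "\<dots> = (\<Sum>g<n. \<Sum>j<n. mat_poly (B $$ (h, g)) A $$ (i, j) * (\<Sum>k<n. mat_poly (M $$ (g, k)) A $$ (j, k)))"
    by (subst sum.swap, rule sum.cong[OF refl], subst sum.swap) (simp add: sum_distrib_left)
  also have "\<dots> = 0" using row by simp
  finally show "mat_poly (char_poly A) A $$ (i, h) = 0\<^sub>m n n $$ (i, h)" using i h by simp
qed (use A in auto)

text \<open>
  The diagonal entries of \<open>B\<^sup>2\<close> are the sums of the squares of the rows of \<open>B\<close>.
\<close>

lemma symmetric_square_zero:
  fixes B :: "int mat"
  assumes B: "B \<in> carrier_mat n n" and sym: "transpose_mat B = B" and sq: "B * B = 0\<^sub>m n n"
  shows "B = 0\<^sub>m n n"
proof (rule eq_matI)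
  fix i j assume "i < dim_row (0\<^sub>m n n :: int mat)" "j < dim_col (0\<^sub>m n n :: int mat)"
  then have i: "i < n" and j: "j < n" by auto
  have "B $$ (j, i) = B $$ (i, j)" if "j < n" for j
    using sym i that by (metis B carrier_matD index_transpose_mat(1))
  then have "(B * B) $$ (i, i) = (\<Sum>j<n. (B $$ (i, j))\<^sup>2)"
    using B i by (auto simp: scalar_prod_def atLeast0LessThan power2_eq_square intro!: sum.cong)
  then have "(\<Sum>j<n. (B $$ (i, j))\<^sup>2) = 0" using sq i by simp
  then show "B $$ (i, j) = 0\<^sub>m n n $$ (i, j)"
    using i j by (subst (asm) sum_nonneg_eq_0_iff) auto
qed (use B in auto)

text \<open>
  For an eigenvector \<open>v\<close> with eigenvalue \<open>z\<close>, the number \<open>v\<^sup>* A v = z |v|\<^sup>2\<close> is its own conjugate.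
\<close>

lemma totally_real_char_poly_symmetric:
  fixes A :: "int mat"
  assumes A: "A \<in> carrier_mat n n" and sym: "transpose_mat A = A"
  shows "totally_real (char_poly A)"
  unfolding totally_real_def
proof (intro allI impI)
  fix z :: complex
  let ?A = "map_mat complex_of_int A"
  have A': "?A \<in> carrier_mat n n" using A by simp
  assume "ipoly (char_poly A) z = 0"
  then have "eigenvalue ?A z"
    by (simp add: eigenvalue_root_char_poly[OF A'] of_int_hom.char_poly_hom[OF A])
  then obtain v where "eigenvector ?A v z" by (auto simp: eigenvalue_def)
  then have v: "v \<in> carrier_vec n" "v \<noteq> 0\<^sub>v n" and Av: "?A *\<^sub>v v = z \<cdot>\<^sub>v v"
    using A by (auto simp: eigenvector_def)
  have row: "(\<Sum>j<n. of_int (A $$ (i, j)) * v $ j) = z * v $ i" if i: "i < n" for i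
  proof -
    have "(?A *\<^sub>v v) $ i = (\<Sum>j<n. of_int (A $$ (i, j)) * v $ j)"
      using A v i by (auto simp: scalar_prod_def atLeast0LessThan intro!: sum.cong)
    then show ?thesis using Av v i by simp
  qed
  define S where "S = (\<Sum>i<n. \<Sum>j<n. cnj (v $ i) * of_int (A $$ (i, j)) * v $ j)"
  define L where "L = (\<Sum>i<n. (cmod (v $ i))\<^sup>2)"
  have "S = (\<Sum>i<n. cnj (v $ i) * (\<Sum>j<n. of_int (A $$ (i, j)) * v $ j))"
    by (simp add: S_def sum_distrib_left mult.assoc)
  also have "\<dots> = (\<Sum>i<n. z * of_real ((cmod (v $ i))\<^sup>2))"
  proof (rule sum.cong[OF refl])
    fix i assume "i \<in> {..<n}"
    then have i: "i < n" by simp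
    show "cnj (v $ i) * (\<Sum>j<n. of_int (A $$ (i, j)) * v $ j) = z * of_real ((cmod (v $ i))\<^sup>2)"
      unfolding row[OF i] complex_norm_square by (simp add: mult_ac)
  qed
  also have "\<dots> = z * of_real L" by (simp add: L_def sum_distrib_left)
  finally have SL: "S = z * of_real L" .
  have "cnj S = (\<Sum>i<n. \<Sum>j<n. v $ i * of_int (A $$ (i, j)) * cnj (v $ j))"
    by (simp add: S_def)
  also have "\<dots> = (\<Sum>j<n. \<Sum>i<n. v $ i * of_int (A $$ (i, j)) * cnj (v $ j))"
    by (rule sum.swap)
  also have "\<dots> = S"
    unfolding S_def
  proof (intro sum.cong refl)
    fix i j assume "i \<in> {..<n}" "j \<in> {..<n}"
    then have "A $$ (j, i) = A $$ (i, j)" using sym by (metis A carrier_matD index_transpose_mat(1) lessThan_iff)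
    then show "v $ j * of_int (A $$ (j, i)) * cnj (v $ i) = cnj (v $ i) * of_int (A $$ (i, j)) * v $ j"
      by simp
  qed
  finally have "S \<in> \<real>" by (simp add: Reals_cnj_iff)
  obtain i where "i < n" "v $ i \<noteq> 0" using v by (metis eq_vecI carrier_vecD index_zero_vec)
  then have "L > 0" unfolding L_def by (intro sum_pos2[of _ i]) auto
  then have "z = S / of_real L" using SL by simp
  then show "z \<in> \<real>" using \<open>S \<in> \<real>\<close> by simp
qed

text \<open>
  If \<open>P\<close> vanishes at all eigenvalues, then the characteristic polynomial divides a power of \<open>P\<close> over the
  complex numbers, so \<open>P(A)\<close> is nilpotent; being symmetric, it is 0. The exponent of this power is taken as
  \<open>2 ^ n\<close> because nilpotency is undone by extracting square roots. The converse evaluates \<open>P(A)\<close> at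
  eigenvectors.
\<close>

theorem mat_poly_eq_0_iff_symmetric:
  fixes A :: "int mat" and P :: "int poly"
  assumes A: "A \<in> carrier_mat n n" and sym: "transpose_mat A = A"
  shows "mat_poly P A = 0\<^sub>m n n \<longleftrightarrow> (\<forall>x::real. ipoly (char_poly A) x = 0 \<longrightarrow> ipoly P x = 0)"
proof
  assume P: "mat_poly P A = 0\<^sub>m n n"
  show "\<forall>x::real. ipoly (char_poly A) x = 0 \<longrightarrow> ipoly P x = 0"
  proof (intro allI impI)
    fix x :: real
    let ?A = "map_mat real_of_int A"
    have A': "?A \<in> carrier_mat n n" using A by simp
    assume "ipoly (char_poly A) x = 0"
    then have "eigenvalue ?A x"
      by (simp add: eigenvalue_root_char_poly[OF A'] of_int_hom.char_poly_hom[OF A])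
    then obtain v where "eigenvector ?A v x" by (auto simp: eigenvalue_def)
    then have v: "v \<in> carrier_vec n" "v \<noteq> 0\<^sub>v n" and Av: "?A *\<^sub>v v = x \<cdot>\<^sub>v v"
      using A by (auto simp: eigenvector_def)
    have "mat_poly (of_int_poly P) ?A = 0\<^sub>m n n"
      unfolding mat_poly_of_int[OF A, symmetric] P by (rule eq_matI) auto
    then have 0: "ipoly P x \<cdot>\<^sub>v v = 0\<^sub>v n"
      using mat_poly_eigenvector[OF A' v(1) Av, of "of_int_poly P"] v by (metis zero_mult_mat_vec)
    obtain i where i: "i < n" "v $ i \<noteq> 0" using v by (metis eq_vecI carrier_vecD index_zero_vec)
    then have "ipoly P x * v $ i = 0" using arg_cong[OF 0, of "\<lambda>u. u $ i"] v by simp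
    with i show "ipoly P x = 0" by simp
  qed
next
  assume P: "\<forall>x::real. ipoly (char_poly A) x = 0 \<longrightarrow> ipoly P x = 0"
  let ?A = "map_mat complex_of_int A" and ?P = "of_int_poly P :: complex poly"
  have A': "?A \<in> carrier_mat n n" using A by simp
  obtain as where as: "char_poly ?A = (\<Prod>a\<leftarrow>as. [:- a, 1:])" "length as = n"
    using char_poly_factorized[OF A'] by blast
  have cp: "char_poly ?A = of_int_poly (char_poly A)" by (simp add: of_int_hom.char_poly_hom[OF A])
  have "[:- a, 1:] dvd ?P" if "a \<in> set as" for a
  proof -
    have "poly (char_poly ?A) a = 0" using that by (auto simp: as poly_prod_list prod_list_zero_iff)
    then have root: "ipoly (char_poly A) a = 0" by (simp add: cp)
    then obtain x where x: "a = complex_of_real x"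
      using totally_real_char_poly_symmetric[OF A sym] by (auto simp: totally_real_def elim: Reals_cases)
    with root P have "ipoly P x = 0" by (simp add: ipoly_of_real)
    then have "ipoly P a = 0" by (simp add: x ipoly_of_real)
    then show ?thesis by (simp add: poly_eq_0_iff_dvd)
  qed
  then have "(\<Prod>a\<leftarrow>as. [:- a, 1:]) dvd ?P ^ length as"
    by (induction as) (auto simp del: mult_pCons_left intro: mult_dvd_mono)
  also have "?P ^ length as dvd ?P ^ (2 ^ n)"
    by (rule le_imp_power_dvd) (simp add: as less_imp_le)
  finally obtain g where g: "?P ^ (2 ^ n) = char_poly ?A * g" unfolding as(1) by (auto simp: dvd_def)
  have sym': "transpose_mat ?A = ?A" using sym by (metis map_mat_transpose)
  have "mat_poly (?P ^ (2 ^ n)) ?A = 0\<^sub>m n n"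
    using A' by (simp add: g mat_poly_mult[OF A'] cayley_hamilton_symmetric[OF A' sym'])
  then have "map_mat complex_of_int (mat_poly (P ^ (2 ^ n)) A) = 0\<^sub>m n n"
    by (simp only: mat_poly_of_int[OF A] of_int_poly_hom.hom_power)
  then have "mat_poly (P ^ (2 ^ n)) A = 0\<^sub>m n n"
  proof -
    assume *: "map_mat complex_of_int (mat_poly (P ^ (2 ^ n)) A) = 0\<^sub>m n n"
    show ?thesis
    proof (rule eq_matI)
      fix i j assume ij: "i < dim_row (0\<^sub>m n n :: int mat)" "j < dim_col (0\<^sub>m n n :: int mat)"
      then have "complex_of_int (mat_poly (P ^ (2 ^ n)) A $$ (i, j)) = 0"
        using arg_cong[OF *, of "\<lambda>B. B $$ (i, j)"] A by simp
      then show "mat_poly (P ^ (2 ^ n)) A $$ (i, j) = 0\<^sub>m n n $$ (i, j)" using ij by simp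
    qed (use A in simp_all)
  qed
  moreover have "mat_poly P A = 0\<^sub>m n n" if "mat_poly (P ^ (2 ^ k)) A = 0\<^sub>m n n" for k
    using that
  proof (induction k)
    case (Suc k)
    let ?B = "mat_poly (P ^ (2 ^ k)) A"
    have "?B * ?B = 0\<^sub>m n n"
      using Suc.prems by (simp add: mat_poly_mult[OF A, symmetric] mult_2 power_add)
    then have "?B = 0\<^sub>m n n"
      using symmetric_square_zero[of ?B n] A mat_poly_transpose[OF A sym] by simp
    then show ?case by (rule Suc.IH)
  qed simp
  ultimately show "mat_poly P A = 0\<^sub>m n n" by blast
qed

corollary mat_poly_eq_1_iff_symmetric:
  fixes A :: "int mat" and P :: "int poly"
  assumes A: "A \<in> carrier_mat n n" and sym: "transpose_mat A = A"
  shows "mat_poly P A = 1\<^sub>m n \<longleftrightarrow> (\<forall>x::real. ipoly (char_poly A) x = 0 \<longrightarrow> ipoly P x = 1)"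
proof -
  have P: "mat_poly P A = mat_poly (P - 1) A + 1\<^sub>m n"
    using mat_poly_add[OF A, of "P - 1" 1] by (simp add: mat_poly_1[OF A])
  have carr: "mat_poly (P - 1) A \<in> carrier_mat n n" using A by simp
  have "mat_poly P A = 1\<^sub>m n \<longleftrightarrow> mat_poly (P - 1) A = 0\<^sub>m n n"
  proof
    assume "mat_poly P A = 1\<^sub>m n"
    then have *: "mat_poly (P - 1) A + 1\<^sub>m n = 1\<^sub>m n" by (simp only: P)
    show "mat_poly (P - 1) A = 0\<^sub>m n n"
    proof (rule eq_matI)
      fix i j assume "i < dim_row (0\<^sub>m n n :: int mat)" "j < dim_col (0\<^sub>m n n :: int mat)"
      then show "mat_poly (P - 1) A $$ (i, j) = 0\<^sub>m n n $$ (i, j)"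
        using arg_cong[OF *, of "\<lambda>B. B $$ (i, j)"] by simp
    qed (use A in simp_all)
  qed (simp add: P)
  then show ?thesis
    unfolding mat_poly_eq_0_iff_symmetric[OF A sym] by (simp add: of_int_poly_hom.hom_minus)
qed

text \<open>
  A polynomial over the field with \<open>q\<close> elements that vanishes at distinct points is divisible by the
  corresponding linear factors; here lifted to the integers, one point at a time.
\<close>

lemma divisible_values_imp_congruent_multiple:
  fixes P :: "int poly" and q :: int
  assumes "finite I" and q: "prime q"
    and "\<And>a b. a \<in> I \<Longrightarrow> b \<in> I \<Longrightarrow> a \<noteq> b \<Longrightarrow> \<not> q dvd a - b"
    and "\<And>a. a \<in> I \<Longrightarrow> q dvd poly P a"
  shows "\<exists>h e. P = (\<Prod>a\<in>I. [:- a, 1:]) * h + smult q e"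
  using assms(1,3,4)
proof (induction I rule: finite_induct)
  case empty
  then show ?case by (intro exI[of _ P] exI[of _ 0]) simp
next
  case (insert a I)
  then obtain h e where P: "P = (\<Prod>a\<in>I. [:- a, 1:]) * h + smult q e" by auto
  have "q dvd (\<Prod>b\<in>I. a - b) * poly h a"
  proof -
    have "poly P a = (\<Prod>b\<in>I. a - b) * poly h a + q * poly e a"
      by (simp add: P poly_prod)
    moreover have "q dvd poly P a" using insert.prems by simp
    ultimately show ?thesis by (simp add: dvd_add_left_iff)
  qed
  moreover have "\<not> q dvd (\<Prod>b\<in>I. a - b)"
  proof
    assume "q dvd (\<Prod>b\<in>I. a - b)"
    then obtain b where "b \<in> I" "q dvd a - b" using insert.hyps q by (auto simp: prime_dvd_prod_iff)
    then show False using insert by auto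
  qed
  ultimately have "q dvd poly h a" using q by (auto simp: prime_dvd_mult_iff)
  then obtain c where c: "poly h a = q * c" by (auto simp: dvd_def)
  have "[:- a, 1:] dvd h - [:poly h a:]" unfolding poly_eq_0_iff_dvd[symmetric] by simp
  then obtain h' where h': "h - [:poly h a:] = [:- a, 1:] * h'" by (auto simp: dvd_def)
  have "[:poly h a:] = smult (q * c) 1" by (simp add: c)
  then have "h = [:- a, 1:] * h' + smult (q * c) 1" using h' by (simp add: diff_eq_eq)
  then have "P = (\<Prod>a\<in>I. [:- a, 1:]) * ([:- a, 1:] * h' + smult (q * c) 1) + smult q e"
    using P by simp
  also have "\<dots> = ((\<Prod>a\<in>insert a I. [:- a, 1:]) * h') + smult q (smult c (\<Prod>a\<in>I. [:- a, 1:]) + e)"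
  proof -
    have "p * (l * h' + smult (q * c) 1) + smult q e = (l * p) * h' + smult q (smult c p + e)"
      for p l :: "int poly"
    proof -
      have "p * (l * h' + smult (q * c) 1) = (l * p) * h' + smult (q * c) p"
        by (simp only: distrib_left mult_smult_right mult_1_right mult_1_left mult_ac)
      moreover have "smult q (smult c p + e) = smult (q * c) p + smult q e"
        by (simp only: smult_add_right smult_smult)
      ultimately show ?thesis by (simp only: add.assoc)
    qed
    then show ?thesis unfolding prod.insert[OF insert.hyps] .
  qed
  finally show ?case by blast
qed

text \<open>
  By Fermat's little theorem the values of \<open>X\<^sup>q - X\<close> at the eigenvalues are divisible by \<open>q\<close>. So this
  polynomial is, up to a multiple of \<open>q\<close>, a multiple of the product of the \<open>X - a\<close> over the distinct
  eigenvalues \<open>a\<close>, and that product annihilates \<open>A\<close>.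
\<close>

lemma symmetric_integer_eigenvalues_frobenius:
  fixes A :: "int mat" and q :: nat
  assumes A: "A \<in> carrier_mat n n" and sym: "transpose_mat A = A"
    and int: "\<And>x::real. ipoly (char_poly A) x = 0 \<Longrightarrow> x \<in> \<int>"
    and q: "prime q"
    and large: "\<And>a b. poly (char_poly A) a = 0 \<Longrightarrow> poly (char_poly A) b = 0 \<Longrightarrow> a \<noteq> b \<Longrightarrow> \<not> int q dvd a - b"
  obtains e where "mat_poly (monom 1 q) A = A + int q \<cdot>\<^sub>m mat_poly e A"
proof -
  let ?f = "char_poly A" and ?X = "[:0, 1:] :: int poly"
  define I where "I = {a. poly ?f a = 0}"
  have "?f \<noteq> 0" using degree_monic_char_poly[OF A] by auto
  then have fin: "finite I" unfolding I_def by (rule poly_roots_finite)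
  have "int q dvd poly (monom 1 q - ?X) a" for a
  proof -
    have "[a ^ q = a] (mod int q)"
    proof (cases "int q dvd a")
      case True
      moreover from this have "int q dvd a ^ q"
        using prime_gt_0_nat[OF q] by (metis dvd_trans dvd_power)
      ultimately show ?thesis by (simp add: cong_iff_dvd_diff)
    next
      case False
      define r where "r = nat (a mod int q)"
      have r: "[int r = a] (mod int q)" using prime_gt_0_nat[OF q] by (simp add: r_def)
      then have "\<not> q dvd r" using False by (metis cong_dvd_iff int_dvd_int_iff cong_sym)
      then have "[r ^ (q - 1) = 1] (mod q)" by (rule fermat_theorem[OF q])
      then have "[r * r ^ (q - 1) = r * 1] (mod q)" by (rule cong_scalar_left)
      then have "[r ^ q = r] (mod q)" using prime_gt_0_nat[OF q] by (simp add: power_eq_if)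
      then have "[int r ^ q = int r] (mod int q)" by (metis cong_int_iff of_nat_power)
      then show ?thesis using r by (meson cong_pow cong_sym cong_trans)
    qed
    then show ?thesis by (simp add: poly_monom cong_iff_dvd_diff)
  qed
  then obtain h e where he: "monom 1 q - ?X = (\<Prod>a\<in>I. [:- a, 1:]) * h + smult (int q) e"
    using divisible_values_imp_congruent_multiple[OF fin, of "int q" "monom 1 q - ?X"] q large
    by (auto simp: I_def)
  have "mat_poly (\<Prod>a\<in>I. [:- a, 1:]) A = 0\<^sub>m n n"
    unfolding mat_poly_eq_0_iff_symmetric[OF A sym]
  proof (intro allI impI)
    fix x :: real assume x: "ipoly ?f x = 0"
    with int obtain a where a: "x = of_int a" by (auto elim: Ints_cases)
    with x have "a \<in> I" by (simp add: I_def)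
    then show "ipoly (\<Prod>a\<in>I. [:- a, 1:]) x = 0"
      using fin by (auto simp: of_int_poly_hom.hom_prod poly_prod a)
  qed
  moreover have "monom 1 q = ?X + ((\<Prod>a\<in>I. [:- a, 1:]) * h + smult (int q) e)"
    using he by (simp add: diff_eq_eq add.commute)
  ultimately have "mat_poly (monom 1 q) A = A + (0\<^sub>m n n + int q \<cdot>\<^sub>m mat_poly e A)"
    using A by (simp only: mat_poly_add[OF A] mat_poly_mult[OF A] mat_poly_smult[OF A] mat_poly_X[OF A]
        left_mult_zero_mat[OF mat_poly_carrier[OF A]])
  then show ?thesis using that[of e] A by simp
qed

section \<open>Elements that are not conjugate to their other powers\<close>

lemma (in group) exists_element_of_prime_order:
  assumes fin: "finite (carrier G)" and p: "prime p" "p dvd order G"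
  obtains x where "x \<in> carrier G" "ord x = p"
proof -
  obtain m where "order G = p ^ 1 * m" using p by (auto simp: dvd_def)
  then obtain H where H: "subgroup H G" "card H = p"
    using sylow_thm[OF p(1) is_group _ fin, of 1 m] by auto
  have "\<exists>x\<in>H. x \<noteq> \<one>"
  proof (rule ccontr)
    assume "\<not> ?thesis"
    then have "H \<subseteq> {\<one>}" by auto
    then have "card H \<le> 1" using card_mono[of "{\<one>}" H] by simp
    then show False using H prime_gt_1_nat[OF p(1)] by simp
  qed
  then obtain x where x: "x \<in> H" "x \<noteq> \<one>" by blast
  have xG: "x \<in> carrier G" using x(1) by (rule subgroup.mem_carrier[OF H(1)])
  have "x [^] p = \<one>"
  proof -
    interpret H: group "G\<lparr>carrier := H\<rparr>" by (rule subgroup_imp_group[OF H(1)])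
    have "x [^] p = x [^]\<^bsub>G\<lparr>carrier := H\<rparr>\<^esub> p" by (rule nat_pow_consistent)
    also have "\<dots> = \<one>" using H.pow_order_eq_1[of x] x H by (simp add: Coset.order_def)
    finally show ?thesis .
  qed
  then have "ord x dvd p" using xG by (simp add: pow_eq_id)
  moreover have "ord x \<noteq> 1" using x(2) ord_eq_1[OF xG] by blast
  ultimately show ?thesis using that[OF xG] p by (auto simp: prime_nat_iff)
qed

lemma (in group) conj_int_pow:
  assumes "g \<in> carrier G" "x \<in> carrier G"
  shows "(g \<otimes> x \<otimes> inv g) [^] (i::int) = g \<otimes> x [^] i \<otimes> inv g"
proof -
  have "(\<lambda>y. g \<otimes> y \<otimes> inv g) \<in> hom G G"
    using assms by (auto simp: hom_def m_assoc) (simp add: m_assoc[symmetric])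
  then interpret group_hom G G "\<lambda>y. g \<otimes> y \<otimes> inv g" by unfold_locales
  show ?thesis using hom_int_pow[OF assms(2), of i] by simp
qed

lemma (in group) nat_pow_eq_iff_cong:
  assumes x: "x \<in> carrier G"
  shows "x [^] (a::nat) = x [^] (b::nat) \<longleftrightarrow> [a = b] (mod ord x)"
proof -
  have "x [^] a = x [^] b \<longleftrightarrow> int (ord x) dvd int b - int a"
    using int_pow_eq[OF x, of "int a" "int b"] by (simp only: int_pow_int)
  also have "\<dots> \<longleftrightarrow> [a = b] (mod ord x)"
    by (simp only: cong_int_iff[symmetric] cong_iff_dvd_diff dvd_diff_commute)
  finally show ?thesis .
qed

text \<open>
  Besides \<open>n\<close>, also \<open>p - 1\<close> is an exponent that takes \<open>j\<close> to 1, and the two are coprime.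
\<close>

lemma coprime_exponent_cong_1:
  fixes j n p :: nat
  assumes p: "prime p" and n: "coprime n (p - 1)" and j: "[j ^ n = 1] (mod p)" and n0: "n > 0"
  shows "[j = 1] (mod p)"
proof (cases "p - 1 = 1")
  case True
  then have p2: "p = 2" by simp
  have "odd j"
  proof
    assume "even j"
    then have "even (j ^ n)" using n0 by simp
    then show False using j by (simp add: p2 cong_def)
  qed
  then show ?thesis by (simp add: p2 cong_def odd_iff_mod_2_eq_one)
next
  case False
  then obtain a b where ab: "n * a = (p - 1) * b + 1"
    using coprime_bezout_strong[OF n] by auto
  have "\<not> p dvd j"
  proof
    assume "p dvd j"
    then have "p dvd j ^ n" using n0 by (metis dvd_power dvd_trans)
    then have "p dvd 1" using j by (metis cong_dvd_iff)
    then show False using p by auto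
  qed
  then have f: "[j ^ (p - 1) = 1] (mod p)" by (rule fermat_theorem[OF p])
  have "[j * (j ^ (p - 1)) ^ b = j * 1 ^ b] (mod p)"
    by (intro cong_scalar_left cong_pow f)
  then have "[j ^ (n * a) = j] (mod p)" by (simp add: ab power_mult)
  moreover have "[(j ^ n) ^ a = 1 ^ a] (mod p)" by (intro cong_pow j)
  ultimately show ?thesis by (simp add: power_mult) (meson cong_sym cong_trans)
qed

text \<open>
  Equivalently, the normaliser of the subgroup generated by \<open>x\<close> is the centraliser of \<open>x\<close>.
\<close>

definition (in group) rigid :: "'a \<Rightarrow> bool" where
  "rigid x \<longleftrightarrow> (\<forall>g\<in>carrier G. \<forall>j::int. g \<otimes> x \<otimes> inv g = x [^] j \<longrightarrow> g \<otimes> x \<otimes> inv g = x)"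

text \<open>
  If \<open>g x g\<inverse> = x\<^sup>j\<close>, then conjugating \<open>|G|\<close> times by \<open>g\<close> shows that \<open>j\<close> to the power \<open>|G|\<close> is 1
  modulo \<open>p\<close>, the order of \<open>x\<close>. But \<open>|G|\<close> is coprime to \<open>p - 1\<close>, whose prime divisors are all
  smaller than \<open>p\<close>.
\<close>

lemma (in group) rigid_smallest_prime:
  assumes fin: "finite (carrier G)" and x: "x \<in> carrier G" and p: "prime (ord x)"
    and least: "\<And>l. prime l \<Longrightarrow> l dvd order G \<Longrightarrow> ord x \<le> l"
  shows "rigid x"
  unfolding rigid_def
proof (intro ballI allI impI)
  fix g and i :: int assume g: "g \<in> carrier G" and gx': "g \<otimes> x \<otimes> inv g = x [^] i"
  let ?p = "ord x"
  define j where "j = nat (i mod int ?p)"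
  have p0: "?p > 0" using p prime_gt_0_nat by blast
  have "x [^] int j = x [^] i" using x p0 by (simp add: int_pow_eq j_def mod_eq_dvd_iff[symmetric])
  then have gx: "g \<otimes> x \<otimes> inv g = x [^] j" by (simp add: gx' int_pow_int)
  have iter: "(g [^] k) \<otimes> x \<otimes> inv (g [^] k) = x [^] (j ^ k)" for k :: nat
  proof (induction k)
    case (Suc k)
    have "(g [^] Suc k) \<otimes> x \<otimes> inv (g [^] Suc k) = g \<otimes> (g [^] k \<otimes> x \<otimes> inv (g [^] k)) \<otimes> inv g"
    proof -
      have "g [^] Suc k = g \<otimes> g [^] k" using g by (rule nat_pow_Suc2)
      then show ?thesis using g x by (simp add: inv_mult_group m_assoc)
    qed
    also have "\<dots> = g \<otimes> (x [^] int (j ^ k)) \<otimes> inv g" by (simp only: Suc.IH int_pow_int)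
    also have "\<dots> = (x [^] j) [^] int (j ^ k)" using conj_int_pow[OF g x] gx by simp
    also have "\<dots> = x [^] (j ^ Suc k)" using x by (simp only: int_pow_int nat_pow_pow power_Suc)
    finally show ?case .
  qed (use x in simp)
  have n0: "order G > 0" using fin by (simp add: order_gt_0_iff_finite)
  have "x [^] (j ^ order G) = x [^] (1::nat)"
    using iter[of "order G"] g x by (simp add: pow_order_eq_1)
  then have "[j ^ order G = 1] (mod ?p)"
    by (simp only: nat_pow_eq_iff_cong[OF x])
  moreover have "coprime (order G) (?p - 1)"
  proof (rule ccontr)
    assume "\<not> coprime (order G) (?p - 1)"
    then have "gcd (order G) (?p - 1) \<noteq> 1" by (simp only: coprime_iff_gcd_eq_1 not_False_eq_True)
    then obtain l where "prime l" "l dvd gcd (order G) (?p - 1)" using prime_factor_nat by blast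
    then have l: "prime l" "l dvd order G" "l dvd ?p - 1" by simp_all
    have "?p - 1 > 0" using prime_gt_1_nat[OF p] by simp
    with l have "l \<le> ?p - 1" by (auto dest: dvd_imp_le)
    with least[OF l(1,2)] \<open>?p - 1 > 0\<close> show False by simp
  qed
  ultimately have "[j = 1] (mod ?p)" using coprime_exponent_cong_1[OF p _ _ n0] by blast
  then have "x [^] j = x [^] (1::nat)"
    by (simp only: nat_pow_eq_iff_cong[OF x])
  with x gx show "g \<otimes> x \<otimes> inv g = x" by simp
qed

text \<open>
  If \<open>g x g\<inverse> = x\<^sup>j\<close>, then the commutator of \<open>x\<^sup>m\<close> and \<open>g\<close> is \<open>x\<close> to the power \<open>m (1 - j)\<close>. Iterating
  this down the lower central series, some power of \<open>1 - j\<close> is divisible by the order of \<open>x\<close>.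
\<close>

lemma (in group) rigid_nilpotent:
  assumes nil: "nilpotent_group G" and x: "x \<in> carrier G" and p: "prime (ord x)"
  shows "rigid x"
  unfolding rigid_def
proof (intro ballI allI impI)
  fix g and j :: int assume g: "g \<in> carrier G" and gx: "g \<otimes> x \<otimes> inv g = x [^] j"
  have mem: "x [^] ((1 - j) ^ n) \<in> lower_central G n" for n
  proof (induction n)
    case (Suc n)
    let ?m = "(1 - j) ^ n"
    have "x [^] ?m \<otimes> g \<otimes> inv (x [^] ?m) \<otimes> inv g = x [^] ?m \<otimes> (g \<otimes> x [^] (- ?m) \<otimes> inv g)"
      using x g by (simp add: m_assoc int_pow_neg)
    also have "g \<otimes> x [^] (- ?m) \<otimes> inv g = x [^] (j * (- ?m))"
      using conj_int_pow[OF g x, of "- ?m"] gx x by (simp add: int_pow_pow)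
    also have "x [^] ?m \<otimes> x [^] (j * (- ?m)) = x [^] (?m + j * (- ?m))"
      by (rule int_pow_mult[OF x, symmetric])
    also have "?m + j * (- ?m) = (1 - j) ^ Suc n" by (simp add: algebra_simps)
    finally have "x [^] ((1 - j) ^ Suc n) = x [^] ?m \<otimes> g \<otimes> inv (x [^] ?m) \<otimes> inv g" by simp
    then show ?case using Suc g
      by (auto simp: commutator_subgroup_def intro!: generate.incl)
  qed (use x in simp)
  obtain n where "lower_central G n = {\<one>}" using nil by (auto simp: nilpotent_group_def)
  with mem[of n] have "x [^] ((1 - j) ^ n) = \<one>" by simp
  then have "int (ord x) dvd (1 - j) ^ n" using x by (simp add: int_pow_eq_id)
  then have "int (ord x) dvd 1 - j" using p prime_dvd_power by (metis prime_nat_int_transfer)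
  then have "x [^] (1::int) = x [^] j" using x int_pow_eq[OF x, of 1 j] by (metis dvd_minus_iff minus_diff_eq)
  with gx x show "g \<otimes> x \<otimes> inv g = x" by simp
qed

section \<open>Large primes and rotations of words\<close>

text \<open>
  A number that is 2 modulo \<open>p\<close> and 1 modulo every other prime up to \<open>B\<close> has only prime factors greater
  than \<open>B\<close>. They cannot all be \<open>\<plusminus>1\<close> modulo \<open>p\<close>, since 2 is not \<open>\<plusminus>1\<close> modulo \<open>p\<close>.
\<close>

lemma exists_large_prime_not_pm1:
  fixes p B :: nat
  assumes p: "prime p" "p \<ge> 5"
  obtains q where "prime q" "q > B" "\<not> [int q = 1] (mod int p)" "\<not> [int q = -1] (mod int p)"
proof -
  define L where "L = {l. prime l \<and> l \<le> B \<and> l \<noteq> p}"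
  have finL: "finite L" by (rule finite_subset[of _ "{..B}"]) (auto simp: L_def)
  have "coprime p (\<Prod>L)"
    by (rule prod_coprime_right) (auto simp: L_def p intro: primes_coprime)
  then obtain N where N: "[N = 2] (mod p)" "[N = 1] (mod \<Prod>L)"
    using binary_chinese_remainder_nat by blast
  have pN: "\<not> p dvd N"
  proof
    assume "p dvd N"
    then have "p dvd 2" using N(1) cong_dvd_iff by blast
    then show False using p by (auto dest: dvd_imp_le)
  qed
  have big: "q > B" if q: "prime q" "q dvd N" for q
  proof (rule ccontr)
    assume "\<not> q > B"
    then have "q \<in> L" using q pN by (auto simp: L_def)
    then have "q dvd \<Prod>L" using finL by (intro dvd_prodI) auto
    then have "[N = 1] (mod q)" using N(2) cong_dvd_modulus_nat by blast
    then have "q dvd 1" using q(2) cong_dvd_iff by blast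
    then show False using q by simp
  qed
  have pm1: "[int M = 1] (mod int p) \<or> [int M = -1] (mod int p)"
    if "M > 0" "\<And>q. prime q \<Longrightarrow> q dvd M \<Longrightarrow> [int q = 1] (mod int p) \<or> [int q = -1] (mod int p)" for M
    using that
  proof (induction M rule: less_induct)
    case (less M)
    show ?case
    proof (cases "M = 1")
      case False
      then obtain q where q: "prime q" "q dvd M" using prime_factor_nat by blast
      then obtain m where m: "M = q * m" by (auto simp: dvd_def)
      have "m > 0" "m < M" using less.prems(1) m prime_gt_1_nat[OF q(1)] by auto
      then have "[int m = 1] (mod int p) \<or> [int m = -1] (mod int p)"
        using less.IH less.prems(2) m by (metis dvd_mult)
      moreover have "[int q = 1] (mod int p) \<or> [int q = -1] (mod int p)" using less.prems(2) q by blast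
      ultimately have "[int q * int m = 1 * 1] (mod int p) \<or> [int q * int m = 1 * -1] (mod int p) \<or>
          [int q * int m = -1 * 1] (mod int p) \<or> [int q * int m = -1 * -1] (mod int p)"
        using cong_mult by blast
      then show ?thesis by (auto simp: m)
    qed simp
  qed
  have "N > 0" using pN by (cases N) auto
  have "\<not> ([int N = 1] (mod int p) \<or> [int N = -1] (mod int p))"
  proof
    have N2: "[2 = int N] (mod int p)" using N(1) by (metis cong_int_iff cong_sym of_nat_numeral)
    assume "[int N = 1] (mod int p) \<or> [int N = -1] (mod int p)"
    then have "[2 = 1] (mod int p) \<or> [2 = -1] (mod int p)" using N2 cong_trans by blast
    then have "int p dvd 1 \<or> int p dvd 3" by (auto simp: cong_iff_dvd_diff)
    then show False using p by (auto dest!: zdvd_imp_le)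
  qed
  with pm1[OF \<open>N > 0\<close>] obtain q where "prime q" "q dvd N"
    "\<not> ([int q = 1] (mod int p) \<or> [int q = -1] (mod int p))" by blast
  with big that show ?thesis by blast
qed

text \<open>
  The words that are not fixed fall into orbits of exactly \<open>q\<close> words under rotation, as \<open>q\<close> is prime.
\<close>

lemma prime_rotation_count:
  fixes F :: "'a list set"
  assumes q: "prime q" and fin: "finite F"
    and F: "\<And>l. l \<in> F \<Longrightarrow> length l = q" "\<And>l. l \<in> F \<Longrightarrow> rotate1 l \<in> F"
  shows "[card F = card {l\<in>F. rotate1 l = l}] (mod q)"
proof -
  define N where "N = {l\<in>F. rotate1 l \<noteq> l}"
  define orb where "orb l = (\<lambda>k. rotate k l) ` {..<q}" for l :: "'a list"
  have q0: "q > 0" using q prime_gt_0_nat by blast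
  have cancel: "l = l'" if "l \<in> F" "l' \<in> F" "rotate k l = rotate k l'" for l l' k
  proof -
    define m where "m = k mod q"
    have m: "rotate m l = rotate m l'" using that F(1) rotate_conv_mod[of k] by (metis m_def)
    have "m \<le> q" using q0 by (simp add: m_def less_imp_le)
    then have "rotate (q - m) (rotate m x) = x" if "length x = q" for x :: "'a list"
      using that by (simp add: rotate_rotate)
    then show ?thesis using m F(1) that by metis
  qed
  have rotF: "rotate k l \<in> F" if "l \<in> F" for k l using that F(2) by (induction k) auto
  have orbI: "rotate k l \<in> orb l" if "l \<in> F" for k l
    using rotate_conv_mod[of k l] F(1)[OF that] q0 by (auto simp: orb_def)
  have card_orb: "card (orb l) = q" if l: "l \<in> N" for l
  proof -
    have lF: "l \<in> F" and nf: "rotate1 l \<noteq> l" using l by (auto simp: N_def)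
    have no: False if ij: "i < j" "j < q" "rotate i l = rotate j l" for i j
    proof -
      define m where "m = j - i"
      have "rotate i (rotate m l) = rotate i l" using ij by (simp add: rotate_rotate m_def)
      then have ml: "rotate m l = l" using cancel rotF lF by metis
      have mult: "rotate (m * a) l = l" for a
        by (induction a) (simp_all add: ml rotate_rotate[symmetric])
      have "\<not> q dvd m" using ij by (auto simp: m_def dest: dvd_imp_le)
      then have "coprime m q" using q by (metis coprime_commute prime_imp_coprime)
      moreover have "q \<noteq> 1" using q by auto
      ultimately obtain a b where "m * a = q * b + 1" using coprime_bezout_strong by blast
      then have "rotate (q * b + 1) l = l" using mult by metis
      then have "rotate ((q * b + 1) mod q) l = l" using rotate_conv_mod[of "q * b + 1" l] F(1)[OF lF] by simp
      moreover have "(q * b + 1) mod q = 1" using prime_gt_1_nat[OF q] by (simp only: mod_mult_self4 mod_less)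
      ultimately show False using nf by simp
    qed
    have "inj_on (\<lambda>k. rotate k l) {..<q}"
      by (rule inj_onI) (metis no lessThan_iff linorder_neqE_nat)
    then show ?thesis by (simp add: orb_def card_image)
  qed
  have orbN: "orb l \<subseteq> N" if l: "l \<in> N" for l
  proof
    fix z assume "z \<in> orb l"
    then obtain k where z: "z = rotate k l" by (auto simp: orb_def)
    have lF: "l \<in> F" and nf: "rotate1 l \<noteq> l" using l by (auto simp: N_def)
    have "rotate1 z \<noteq> z"
    proof
      assume "rotate1 z = z"
      then have "rotate k (rotate1 l) = rotate k l" by (simp add: z rotate1_rotate_swap)
      then show False using cancel[OF F(2)[OF lF] lF] nf by blast
    qed
    then show "z \<in> N" using rotF lF by (simp add: N_def z)
  qed
  have self: "l \<in> orb l" for l using q0 by (force simp: orb_def intro: image_eqI[of _ _ 0])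
  have orb_eq: "orb z = orb l" if z: "z \<in> orb l" and l: "l \<in> F" for z l
  proof -
    obtain k where k: "k < q" "z = rotate k l" using z by (auto simp: orb_def)
    have zF: "z \<in> F" using k rotF l by simp
    have l_z: "l = rotate (q - k) z" using k F(1)[OF l] by (simp add: rotate_rotate)
    have 1: "rotate i l \<in> orb z" for i
      using orbI[OF zF, of "i + (q - k)"] by (subst l_z) (simp add: rotate_rotate)
    have 2: "rotate i z \<in> orb l" for i
      using orbI[OF l, of "i + k"] by (simp add: k rotate_rotate)
    have "w \<in> orb z" if "w \<in> orb l" for w
    proof -
      obtain i where "w = rotate i l" using \<open>w \<in> orb l\<close> unfolding orb_def by blast
      then show ?thesis using 1 by simp
    qed
    moreover have "w \<in> orb l" if "w \<in> orb z" for w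
    proof -
      obtain i where "w = rotate i z" using \<open>w \<in> orb z\<close> unfolding orb_def by blast
      then show ?thesis using 2 by simp
    qed
    ultimately show ?thesis by blast
  qed
  have finN: "finite N" using fin by (simp add: N_def)
  have UN: "\<Union>(orb ` N) = N" using orbN self by blast
  have "q * card (orb ` N) = card (\<Union>(orb ` N))"
  proof (rule card_partition)
    show "finite (orb ` N)" "finite (\<Union>(orb ` N))" using finN UN by simp_all
    show "card c = q" if "c \<in> orb ` N" for c using that card_orb by auto
    show "c1 \<inter> c2 = {}" if c: "c1 \<in> orb ` N" "c2 \<in> orb ` N" "c1 \<noteq> c2" for c1 c2
    proof (rule ccontr)
      assume "c1 \<inter> c2 \<noteq> {}"
      then obtain z where "z \<in> c1" "z \<in> c2" by blast
      moreover obtain l1 l2 where "l1 \<in> N" "c1 = orb l1" "l2 \<in> N" "c2 = orb l2" using c by blast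
      ultimately have "c1 = c2" using orb_eq[of z l1] orb_eq[of z l2] by (auto simp: N_def)
      with c show False by blast
    qed
  qed
  then have "card N = q * card (orb ` N)" using UN by simp
  moreover have "card F = card {l\<in>F. rotate1 l = l} + card N"
  proof -
    have "F = {l\<in>F. rotate1 l = l} \<union> N" by (auto simp: N_def)
    then show ?thesis using fin finN by (metis (no_types, lifting) N_def card_Un_disjoint disjoint_iff finite_Un mem_Collect_eq)
  qed
  ultimately show ?thesis by (simp add: cong_def)
qed

section \<open>The integral group ring and its regular representation\<close>

locale finite_group = group G for G (structure) +
  assumes finite_carrier: "finite (carrier G)"
begin

abbreviation R where "R \<equiv> integral_group_ring G"

sublocale R: ring R
  by (rule ring_integral_group_ring[OF is_group finite_carrier])

lemma R_carrier: "carrier R = {f. \<forall>x. x \<notin> carrier G \<longrightarrow> f x = 0}"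
  by (rule carrier_integral_group_ring_finite[OF is_group finite_carrier])

lemma R_mult:
  "f \<in> carrier R \<Longrightarrow> x \<in> carrier G \<Longrightarrow> (f \<otimes>\<^bsub>R\<^esub> g) x = (\<Sum>y\<in>carrier G. f y * g (inv y \<otimes> x))"
  by (simp add: mult_integral_group_ring_finite[OF is_group finite_carrier])

lemma R_add: "(f \<oplus>\<^bsub>R\<^esub> g) x = f x + g x"
  by (simp add: integral_group_ring_def)

lemma R_one: "\<one>\<^bsub>R\<^esub> x = (if x = \<one> then 1 else 0)"
  by (simp add: integral_group_ring_def)

lemma R_eqI:
  assumes "f \<in> carrier R" "g \<in> carrier R" "\<And>x. x \<in> carrier G \<Longrightarrow> f x = g x"
  shows "f = g"
proof
  fix x
  show "f x = g x" using assms by (cases "x \<in> carrier G") (simp_all add: R_carrier)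
qed

definition R_central :: "('a \<Rightarrow> int) \<Rightarrow> bool" where
  "R_central f \<longleftrightarrow> f \<in> carrier R \<and> (\<forall>g\<in>carrier R. f \<otimes>\<^bsub>R\<^esub> g = g \<otimes>\<^bsub>R\<^esub> f)"

lemma R_central_const: "R_central (\<lambda>x. a * \<one>\<^bsub>R\<^esub> x)"
  unfolding R_central_def
proof (intro conjI ballI)
  show car: "(\<lambda>x. a * \<one>\<^bsub>R\<^esub> x) \<in> carrier R" using R.one_closed by (simp add: R_carrier)
  fix g assume g: "g \<in> carrier R"
  show "(\<lambda>x. a * \<one>\<^bsub>R\<^esub> x) \<otimes>\<^bsub>R\<^esub> g = g \<otimes>\<^bsub>R\<^esub> (\<lambda>x. a * \<one>\<^bsub>R\<^esub> x)"
  proof (rule R_eqI)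
    fix x assume x: "x \<in> carrier G"
    have "((\<lambda>x. a * \<one>\<^bsub>R\<^esub> x) \<otimes>\<^bsub>R\<^esub> g) x = a * (\<one>\<^bsub>R\<^esub> \<otimes>\<^bsub>R\<^esub> g) x"
      by (simp add: R_mult[OF car x] R_mult[OF R.one_closed x] sum_distrib_left mult.assoc del: R.l_one)
    also have "\<dots> = a * (g \<otimes>\<^bsub>R\<^esub> \<one>\<^bsub>R\<^esub>) x" using g by simp
    also have "\<dots> = (g \<otimes>\<^bsub>R\<^esub> (\<lambda>x. a * \<one>\<^bsub>R\<^esub> x)) x"
      by (simp add: R_mult[OF g x] sum_distrib_left mult_ac del: R.r_one)
    finally show "((\<lambda>x. a * \<one>\<^bsub>R\<^esub> x) \<otimes>\<^bsub>R\<^esub> g) x = (g \<otimes>\<^bsub>R\<^esub> (\<lambda>x. a * \<one>\<^bsub>R\<^esub> x)) x" .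
  qed (use g car in simp_all)
qed

lemma R_central_add: "R_central f \<Longrightarrow> R_central g \<Longrightarrow> R_central (f \<oplus>\<^bsub>R\<^esub> g)"
  by (auto simp: R_central_def R.l_distr R.r_distr)

lemma R_central_mult:
  assumes "R_central f" "R_central g" shows "R_central (f \<otimes>\<^bsub>R\<^esub> g)"
  unfolding R_central_def
proof (intro conjI ballI)
  have fg: "f \<in> carrier R" "g \<in> carrier R" using assms by (auto simp: R_central_def)
  then show "f \<otimes>\<^bsub>R\<^esub> g \<in> carrier R" by simp
  fix k assume k: "k \<in> carrier R"
  have fk: "f \<otimes>\<^bsub>R\<^esub> k = k \<otimes>\<^bsub>R\<^esub> f" and gk: "g \<otimes>\<^bsub>R\<^esub> k = k \<otimes>\<^bsub>R\<^esub> g"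
    using assms k unfolding R_central_def by blast+
  have "f \<otimes>\<^bsub>R\<^esub> g \<otimes>\<^bsub>R\<^esub> k = f \<otimes>\<^bsub>R\<^esub> (k \<otimes>\<^bsub>R\<^esub> g)"
    unfolding R.m_assoc[OF fg k] gk ..
  also have "\<dots> = (k \<otimes>\<^bsub>R\<^esub> f) \<otimes>\<^bsub>R\<^esub> g" by (simp only: R.m_assoc[OF fg(1) k fg(2), symmetric] fk)
  also have "\<dots> = k \<otimes>\<^bsub>R\<^esub> (f \<otimes>\<^bsub>R\<^esub> g)" by (rule R.m_assoc[OF k fg])
  finally show "f \<otimes>\<^bsub>R\<^esub> g \<otimes>\<^bsub>R\<^esub> k = k \<otimes>\<^bsub>R\<^esub> (f \<otimes>\<^bsub>R\<^esub> g)" .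
qed

definition enum :: "nat \<Rightarrow> 'a" where
  "enum = (SOME h. bij_betw h {..<order G} (carrier G))"

lemma bij_enum: "bij_betw enum {..<order G} (carrier G)"
proof -
  obtain h where "bij_betw h {0..<card (carrier G)} (carrier G)"
    using ex_bij_betw_nat_finite[OF finite_carrier] by blast
  then have "bij_betw h {..<order G} (carrier G)" by (simp only: Coset.order_def atLeast0LessThan)
  then show ?thesis unfolding enum_def by (rule someI[of "\<lambda>h. bij_betw h {..<order G} (carrier G)"])
qed

lemma enum_carrier [simp]: "i < order G \<Longrightarrow> enum i \<in> carrier G"
  using bij_enum by (auto simp: bij_betw_def)

lemma enum_eq_iff: "i < order G \<Longrightarrow> j < order G \<Longrightarrow> enum i = enum j \<longleftrightarrow> i = j"
  using bij_enum by (auto simp: bij_betw_def inj_on_def)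

lemma enum_surj: "x \<in> carrier G \<Longrightarrow> \<exists>i<order G. enum i = x"
  using bij_betw_imp_surj_on[OF bij_enum] by (metis imageE lessThan_iff)

text \<open>
  The matrix of left multiplication by \<open>u\<close> with respect to the basis of group elements: the
  coefficient of \<open>g\<close> in \<open>u h\<close> is \<open>u (g h\<inverse>)\<close>.
\<close>

definition regular_mat :: "('a \<Rightarrow> int) \<Rightarrow> int mat" where
  "regular_mat u = mat (order G) (order G) (\<lambda>(i, j). u (enum i \<otimes> inv (enum j)))"

lemma regular_mat_carrier [simp]: "regular_mat u \<in> carrier_mat (order G) (order G)"
  by (simp add: regular_mat_def)

lemma regular_mat_mult:
  assumes u: "u \<in> carrier R"
  shows "regular_mat (u \<otimes>\<^bsub>R\<^esub> v) = regular_mat u * regular_mat v"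
proof (rule eq_matI)
  fix i j assume "i < dim_row (regular_mat u * regular_mat v)" "j < dim_col (regular_mat u * regular_mat v)"
  then have ij: "i < order G" "j < order G" by (auto simp: regular_mat_def)
  let ?x = "enum i" and ?z = "enum j"
  have xz: "?x \<in> carrier G" "?z \<in> carrier G" using ij by simp_all
  have "(u \<otimes>\<^bsub>R\<^esub> v) (?x \<otimes> inv ?z) = (\<Sum>y\<in>carrier G. u y * v (inv y \<otimes> (?x \<otimes> inv ?z)))"
    using u xz by (simp add: R_mult)
  also have "\<dots> = (\<Sum>w\<in>carrier G. u (?x \<otimes> inv w) * v (w \<otimes> inv ?z))"
  proof (rule sum.reindex_bij_witness[of _ "\<lambda>w. ?x \<otimes> inv w" "\<lambda>y. inv y \<otimes> ?x"])
    fix y assume y: "y \<in> carrier G"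
    show "?x \<otimes> inv (inv y \<otimes> ?x) = y" using y xz by (simp add: inv_mult_group m_assoc[symmetric])
    show "inv (?x \<otimes> inv y) \<otimes> ?x = y" using y xz by (simp add: inv_mult_group m_assoc)
    show "u (?x \<otimes> inv (inv y \<otimes> ?x)) * v (inv y \<otimes> ?x \<otimes> inv ?z) = u y * v (inv y \<otimes> (?x \<otimes> inv ?z))"
      using y xz by (simp add: inv_mult_group m_assoc[symmetric])
  qed (use xz in auto)
  also have "\<dots> = (\<Sum>k<order G. u (?x \<otimes> inv (enum k)) * v (enum k \<otimes> inv ?z))"
    by (rule sum.reindex_bij_betw[OF bij_enum, symmetric])
  finally show "regular_mat (u \<otimes>\<^bsub>R\<^esub> v) $$ (i, j) = (regular_mat u * regular_mat v) $$ (i, j)"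
    using ij by (simp add: regular_mat_def scalar_prod_def atLeast0LessThan)
qed (auto simp: regular_mat_def)

lemma regular_mat_one: "regular_mat \<one>\<^bsub>R\<^esub> = 1\<^sub>m (order G)"
proof (rule eq_matI)
  fix i j assume "i < dim_row (1\<^sub>m (order G) :: int mat)" "j < dim_col (1\<^sub>m (order G) :: int mat)"
  then have ij: "i < order G" "j < order G" by auto
  then have "enum i \<otimes> inv (enum j) = \<one> \<longleftrightarrow> i = j"
    by (metis enum_carrier enum_eq_iff inv_closed inv_equality inv_inv r_inv)
  then show "regular_mat \<one>\<^bsub>R\<^esub> $$ (i, j) = 1\<^sub>m (order G) $$ (i, j)"
    using ij by (simp add: regular_mat_def R_one)
qed (auto simp: regular_mat_def)

lemma regular_mat_index:
  assumes "x \<in> carrier G"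
  obtains i j where "i < order G" "j < order G" "x = enum i \<otimes> inv (enum j)"
proof -
  obtain i j where "i < order G" "enum i = x" "j < order G" "enum j = \<one>"
    using enum_surj[OF assms] enum_surj[OF one_closed] by blast
  then show ?thesis using that[of i j] assms by simp
qed

lemma regular_mat_pointwise:
  assumes "regular_mat u = regular_mat v" "x \<in> carrier G"
  shows "u x = v x"
proof -
  obtain i j where ij: "i < order G" "j < order G" "x = enum i \<otimes> inv (enum j)"
    using regular_mat_index[OF assms(2)] .
  then show ?thesis using arg_cong[OF assms(1), of "\<lambda>A. A $$ (i, j)"] by (simp add: regular_mat_def)
qed

text \<open>
  Polynomials in the matrix of a central element are again matrices of central elements, so that units
  found among the matrices are units of the group ring.
\<close>

lemma regular_mat_poly:
  assumes t: "R_central t"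
  shows "\<exists>u. R_central u \<and> regular_mat u = mat_poly P (regular_mat t)"
proof (induction P)
  case 0
  have "regular_mat (\<lambda>x. 0 * \<one>\<^bsub>R\<^esub> x) = 0\<^sub>m (order G) (order G)"
    by (auto simp: regular_mat_def)
  then show ?case using R_central_const[of 0] by (metis mat_poly_0 regular_mat_carrier)
next
  case (pCons a P)
  then obtain u where u: "R_central u" "regular_mat u = mat_poly P (regular_mat t)" by blast
  let ?c = "\<lambda>x. a * \<one>\<^bsub>R\<^esub> x"
  have "regular_mat ?c = a \<cdot>\<^sub>m regular_mat \<one>\<^bsub>R\<^esub>" by (auto simp: regular_mat_def)
  moreover have "regular_mat (?c \<oplus>\<^bsub>R\<^esub> t \<otimes>\<^bsub>R\<^esub> u) = regular_mat ?c + regular_mat (t \<otimes>\<^bsub>R\<^esub> u)"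
    by (auto simp: regular_mat_def R_add)
  moreover have "t \<in> carrier R" using t by (simp add: R_central_def)
  ultimately have "regular_mat (?c \<oplus>\<^bsub>R\<^esub> t \<otimes>\<^bsub>R\<^esub> u) = mat_poly (pCons a P) (regular_mat t)"
    by (simp add: regular_mat_mult regular_mat_one u mat_poly_pCons[OF regular_mat_carrier])
  then show ?case using R_central_add[OF R_central_const R_central_mult[OF t u(1)]] by blast
qed

lemma regular_mat_pow:
  assumes t: "t \<in> carrier R"
  shows "regular_mat (t [^]\<^bsub>R\<^esub> m) = mat_poly (monom 1 m) (regular_mat t)"
proof (induction m)
  case 0
  have "monom 1 0 = (1 :: int poly)" by (rule monom_eq_1)
  then show ?case by (simp only: R.nat_pow_0 regular_mat_one mat_poly_1[OF regular_mat_carrier])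
next
  case (Suc m)
  have "regular_mat (t [^]\<^bsub>R\<^esub> Suc m) = mat_poly (monom 1 m) (regular_mat t) * mat_poly [:0, 1:] (regular_mat t)"
    using t by (simp only: R.nat_pow_Suc regular_mat_mult R.nat_pow_closed Suc mat_poly_X[OF regular_mat_carrier])
  also have "\<dots> = mat_poly (monom 1 m * [:0, 1:]) (regular_mat t)"
    by (simp only: mat_poly_mult[OF regular_mat_carrier])
  also have "monom 1 m * [:0, 1:] = (monom 1 (Suc m) :: int poly)"
    by (simp only: monom_altdef smult_1_left power_Suc mult.commute)
  finally show ?case .
qed

section \<open>Powers of class sums\<close>

definition list_prod :: "'a list \<Rightarrow> 'a" where
  "list_prod l = foldr (\<otimes>) l \<one>"

lemma list_prod_simps [simp]:
  "list_prod [] = \<one>" "list_prod (x # l) = x \<otimes> list_prod l"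
  by (simp_all add: list_prod_def)

lemma list_prod_closed [simp]: "set l \<subseteq> carrier G \<Longrightarrow> list_prod l \<in> carrier G"
  by (induction l) auto

lemma list_prod_append:
  "set l \<subseteq> carrier G \<Longrightarrow> set k \<subseteq> carrier G \<Longrightarrow> list_prod (l @ k) = list_prod l \<otimes> list_prod k"
  by (induction l) (auto simp: m_assoc)

lemma list_prod_replicate: "x \<in> carrier G \<Longrightarrow> list_prod (replicate m x) = x [^] m"
proof (induction m)
  case (Suc m)
  then have "list_prod (replicate (Suc m) x) = x \<otimes> x [^] m" by (simp only: replicate_Suc list_prod_simps)
  also have "\<dots> = x [^] Suc m" using Suc.prems by (rule nat_pow_Suc2[symmetric])
  finally show ?case .
qed simp

definition indicator_elt :: "'a set \<Rightarrow> 'a \<Rightarrow> int" where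
  "indicator_elt K x = (if x \<in> K then 1 else 0)"

lemma indicator_elt_carrier: "K \<subseteq> carrier G \<Longrightarrow> indicator_elt K \<in> carrier R"
  by (auto simp: R_carrier indicator_elt_def)

text \<open>
  Expanding the power of the sum of all elements of \<open>K\<close> gives one term for each word over \<open>K\<close>.
\<close>

lemma indicator_elt_pow:
  assumes K: "K \<subseteq> carrier G" and y: "y \<in> carrier G"
  shows "(indicator_elt K [^]\<^bsub>R\<^esub> m) y = int (card {l. length l = m \<and> set l \<subseteq> K \<and> list_prod l = y})"
  using y
proof (induction m arbitrary: y)
  case 0
  have "{l. length l = 0 \<and> set l \<subseteq> K \<and> list_prod l = y} = (if y = \<one> then {[]} else {})"
    by (auto simp only: length_0_conv list_prod_simps set_simps split: if_split)
  then show ?case by (simp only: R.nat_pow_0 R_one card.empty card_1_singleton_iff split: if_split) simp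
next
  case (Suc m)
  note t = indicator_elt_carrier[OF K]
  let ?S = "\<lambda>m y. {l. length l = m \<and> set l \<subseteq> K \<and> list_prod l = y}"
  have finK: "finite K" using K finite_carrier finite_subset by blast
  have finS: "finite (?S m z)" for z
    by (rule finite_subset[OF _ finite_lists_length_eq[OF finK, of m]]) auto
  have dec: "?S (Suc m) y = (\<Union>k\<in>K. (#) k ` ?S m (inv k \<otimes> y))"
  proof (intro equalityI subsetI)
    fix l assume l: "l \<in> ?S (Suc m) y"
    then obtain k l' where kl: "l = k # l'" by (cases l) auto
    have "k \<in> carrier G" "set l' \<subseteq> carrier G" "k \<otimes> list_prod l' = y" using l K kl by auto
    then have "list_prod l' = inv k \<otimes> y" using inv_solve_left[of "list_prod l'" k y] Suc.prems by simp
    then show "l \<in> (\<Union>k\<in>K. (#) k ` ?S m (inv k \<otimes> y))" using l kl by auto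
  next
    fix l assume "l \<in> (\<Union>k\<in>K. (#) k ` ?S m (inv k \<otimes> y))"
    then obtain k l' where kl: "k \<in> K" "l = k # l'" and l': "length l' = m" "set l' \<subseteq> K" "list_prod l' = inv k \<otimes> y"
      by blast
    then have "k \<in> carrier G" "set l' \<subseteq> carrier G" using K by auto
    then have "k \<otimes> list_prod l' = y" using inv_solve_left[of "list_prod l'" k y] Suc.prems l'(3) by simp
    then show "l \<in> ?S (Suc m) y" using kl l'(1,2) by simp
  qed
  have "(indicator_elt K [^]\<^bsub>R\<^esub> Suc m) y = (indicator_elt K \<otimes>\<^bsub>R\<^esub> indicator_elt K [^]\<^bsub>R\<^esub> m) y"
    using R.nat_pow_Suc2[OF t] by simp
  also have "\<dots> = (\<Sum>k\<in>carrier G. indicator_elt K k * (indicator_elt K [^]\<^bsub>R\<^esub> m) (inv k \<otimes> y))"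
    by (rule R_mult[OF t Suc.prems])
  also have "\<dots> = (\<Sum>k\<in>K. (indicator_elt K [^]\<^bsub>R\<^esub> m) (inv k \<otimes> y))"
    by (rule sum.mono_neutral_cong_right) (use K finite_carrier in \<open>auto simp: indicator_elt_def\<close>)
  also have "\<dots> = (\<Sum>k\<in>K. int (card (?S m (inv k \<otimes> y))))"
    by (rule sum.cong[OF refl], rule Suc.IH) (use K Suc.prems in auto)
  also have "\<dots> = (\<Sum>k\<in>K. int (card ((#) k ` ?S m (inv k \<otimes> y))))"
    by (intro sum.cong refl) (simp add: card_image inj_on_def)
  also have "\<dots> = int (card (?S (Suc m) y))"
    unfolding dec by (subst card_UN_disjoint) (use finK finS in auto)
  finally show ?case .
qed

definition conj_class :: "'a \<Rightarrow> 'a set" where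
  "conj_class x = (\<lambda>g. g \<otimes> x \<otimes> inv g) ` carrier G"

lemma conj_class_subset: "x \<in> carrier G \<Longrightarrow> conj_class x \<subseteq> carrier G"
  by (auto simp: conj_class_def)

lemma conj_class_self: "x \<in> carrier G \<Longrightarrow> x \<in> conj_class x"
  unfolding conj_class_def by (rule image_eqI[of _ _ \<one>]) auto

lemma conj_class_closed:
  assumes x: "x \<in> carrier G" and y: "y \<in> conj_class x" and g: "g \<in> carrier G"
  shows "g \<otimes> y \<otimes> inv g \<in> conj_class x"
proof -
  obtain k where k: "k \<in> carrier G" "y = k \<otimes> x \<otimes> inv k" using y by (auto simp: conj_class_def)
  have "g \<otimes> y \<otimes> inv g = (g \<otimes> k) \<otimes> x \<otimes> inv (g \<otimes> k)"
    using x g k by (simp add: m_assoc inv_mult_group)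
  then show ?thesis unfolding conj_class_def using g k by blast
qed

lemma conj_class_inv:
  assumes x: "x \<in> carrier G" and y: "y \<in> conj_class x"
  shows "inv y \<in> conj_class (inv x)"
proof -
  obtain k where k: "k \<in> carrier G" "y = k \<otimes> x \<otimes> inv k" using y by (auto simp: conj_class_def)
  have "inv y = k \<otimes> inv x \<otimes> inv k" using x k by (simp add: m_assoc inv_mult_group)
  then show ?thesis unfolding conj_class_def using k by blast
qed

lemma indicator_elt_central:
  assumes K: "K \<subseteq> carrier G" and conj: "\<And>y g. y \<in> K \<Longrightarrow> g \<in> carrier G \<Longrightarrow> g \<otimes> y \<otimes> inv g \<in> K"
  shows "R_central (indicator_elt K)"
  unfolding R_central_def
proof (intro conjI ballI)
  note t = indicator_elt_carrier[OF K]
  show "indicator_elt K \<in> carrier R" by (rule t)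
  fix v assume v: "v \<in> carrier R"
  show "indicator_elt K \<otimes>\<^bsub>R\<^esub> v = v \<otimes>\<^bsub>R\<^esub> indicator_elt K"
  proof (rule R_eqI)
    fix x assume x: "x \<in> carrier G"
    have "(indicator_elt K \<otimes>\<^bsub>R\<^esub> v) x = (\<Sum>y\<in>carrier G. indicator_elt K y * v (inv y \<otimes> x))"
      by (rule R_mult[OF t x])
    also have "\<dots> = (\<Sum>z\<in>carrier G. indicator_elt K (x \<otimes> inv z) * v z)"
    proof (rule sum.reindex_bij_witness[of _ "\<lambda>z. x \<otimes> inv z" "\<lambda>y. inv y \<otimes> x"])
      fix y assume y: "y \<in> carrier G"
      show "x \<otimes> inv (inv y \<otimes> x) = y" using y x by (simp add: inv_mult_group m_assoc[symmetric])
      then show "indicator_elt K (x \<otimes> inv (inv y \<otimes> x)) * v (inv y \<otimes> x) = indicator_elt K y * v (inv y \<otimes> x)"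
        by simp
      show "inv (x \<otimes> inv y) \<otimes> x = y" using y x by (simp add: inv_mult_group m_assoc)
    qed (use x in auto)
    also have "\<dots> = (\<Sum>z\<in>carrier G. v z * indicator_elt K (inv z \<otimes> x))"
    proof (rule sum.cong[OF refl])
      fix z assume z: "z \<in> carrier G"
      have a: "inv z \<otimes> (x \<otimes> inv z) \<otimes> z = inv z \<otimes> x" using x z by (simp add: m_assoc)
      have b: "z \<otimes> (inv z \<otimes> x) \<otimes> inv z = x \<otimes> inv z" using x z by (simp add: m_assoc[symmetric])
      have "x \<otimes> inv z \<in> K \<longleftrightarrow> inv z \<otimes> x \<in> K"
        using conj[of "x \<otimes> inv z" "inv z"] conj[of "inv z \<otimes> x" z] z by (auto simp: a b)
      then show "indicator_elt K (x \<otimes> inv z) * v z = v z * indicator_elt K (inv z \<otimes> x)"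
        by (simp add: indicator_elt_def)
    qed
    also have "\<dots> = (v \<otimes>\<^bsub>R\<^esub> indicator_elt K) x" by (rule R_mult[OF v x, symmetric])
    finally show "(indicator_elt K \<otimes>\<^bsub>R\<^esub> v) x = (v \<otimes>\<^bsub>R\<^esub> indicator_elt K) x" .
  qed (use t v in simp_all)
qed

text \<open>
  The left-hand side counts the words of length \<open>q\<close> over \<open>K\<close> with product in \<open>C\<close>. Rotating a word
  conjugates its product, so rotation acts on these words; the fixed ones are the constant words.
\<close>

lemma class_sum_indicator_pow_cong:
  assumes K: "K \<subseteq> carrier G" and C: "C \<subseteq> carrier G"
    and conj: "\<And>y g. y \<in> C \<Longrightarrow> g \<in> carrier G \<Longrightarrow> g \<otimes> y \<otimes> inv g \<in> C" and q: "prime q"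
  shows "[(\<Sum>y\<in>C. (indicator_elt K [^]\<^bsub>R\<^esub> q) y) = int (card {k\<in>K. k [^] q \<in> C})] (mod int q)"
proof -
  let ?S = "\<lambda>y. {l. length l = q \<and> set l \<subseteq> K \<and> list_prod l = y}"
  define F where "F = {l. length l = q \<and> set l \<subseteq> K \<and> list_prod l \<in> C}"
  have finK: "finite K" and finC: "finite C" using K C finite_carrier finite_subset by blast+
  have finL: "finite {l. set l \<subseteq> K \<and> length l = q}" by (rule finite_lists_length_eq[OF finK])
  have finF: "finite F" by (rule finite_subset[OF _ finL]) (auto simp: F_def)
  have finS: "finite (?S y)" for y by (rule finite_subset[OF _ finL]) auto
  have "(\<Sum>y\<in>C. (indicator_elt K [^]\<^bsub>R\<^esub> q) y) = (\<Sum>y\<in>C. int (card (?S y)))"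
    using C by (intro sum.cong refl indicator_elt_pow[OF K]) auto
  also have "\<dots> = int (card (\<Union>y\<in>C. ?S y))"
    by (subst card_UN_disjoint) (use finC finS in auto)
  also have "(\<Union>y\<in>C. ?S y) = F" by (auto simp: F_def)
  finally have 1: "(\<Sum>y\<in>C. (indicator_elt K [^]\<^bsub>R\<^esub> q) y) = int (card F)" .
  have rot: "rotate1 l \<in> F" if l: "l \<in> F" for l
  proof (cases l)
    case (Cons k l')
    have k: "k \<in> carrier G" and l': "set l' \<subseteq> carrier G" using l Cons K by (auto simp: F_def)
    have "list_prod (rotate1 l) = list_prod l' \<otimes> k" using k l' by (simp add: Cons list_prod_append)
    also have "\<dots> = inv k \<otimes> list_prod l \<otimes> inv (inv k)" using k l' by (simp add: Cons m_assoc[symmetric])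
    also have "\<dots> \<in> C" using conj[of "list_prod l" "inv k"] l k by (auto simp: F_def)
    finally show ?thesis using l by (simp add: F_def)
  qed (use l in simp)
  have "{l\<in>F. rotate1 l = l} = replicate q ` {k\<in>K. k [^] q \<in> C}"
  proof (intro equalityI subsetI)
    fix l assume l: "l \<in> {l\<in>F. rotate1 l = l}"
    then have len: "length l = q" and rl: "rotate1 l = l" by (auto simp: F_def)
    have "q > 0" using q prime_gt_0_nat by blast
    have step: "l ! Suc i = l ! i" if "Suc i < q" for i
      using nth_rotate1[of i l] that rl len by (metis Suc_lessD mod_less)
    have all: "l ! i = l ! 0" if "i < q" for i using that by (induction i) (auto simp: step)
    have "l = replicate q (l ! 0)"
    proof (rule nth_equalityI)
      fix i assume "i < length l"
      then show "l ! i = replicate q (l ! 0) ! i" using all[of i] len nth_replicate[of i q] by simp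
    qed (simp add: len)
    moreover have "l ! 0 \<in> K" using l len \<open>q > 0\<close> by (auto simp: F_def)
    ultimately show "l \<in> replicate q ` {k\<in>K. k [^] q \<in> C}"
      using l K list_prod_replicate[of "l ! 0" q] by (auto simp: F_def)
  next
    fix l assume "l \<in> replicate q ` {k\<in>K. k [^] q \<in> C}"
    then obtain k where k: "k \<in> K" "k [^] q \<in> C" "l = replicate q k" by auto
    have "rotate1 l = l" unfolding k by (cases q) (simp_all add: replicate_append_same)
    then show "l \<in> {l\<in>F. rotate1 l = l}"
      using k K by (auto simp: F_def list_prod_replicate subset_iff)
  qed
  moreover have "inj_on (replicate q) {k\<in>K. k [^] q \<in> C}"
    using q by (auto simp: inj_on_def)
  ultimately have "card {l\<in>F. rotate1 l = l} = card {k\<in>K. k [^] q \<in> C}"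
    by (simp add: card_image)
  moreover have "[card F = card {l\<in>F. rotate1 l = l}] (mod q)"
    by (rule prime_rotation_count[OF q finF _ rot]) (auto simp: F_def)
  ultimately show ?thesis unfolding 1 by (simp add: cong_int_iff)
qed

section \<open>A nontrivial central unit\<close>

text \<open>
  The symmetry of \<open>u\<close> means \<open>z = z\<inverse>\<close>.
\<close>

lemma symmetric_trivial_unit_square:
  assumes z: "z \<in> carrier G" and u: "u = group_ring_of z \<or> u = \<ominus>\<^bsub>R\<^esub> group_ring_of z"
    and sym: "\<And>x. x \<in> carrier G \<Longrightarrow> u (inv x) = u x"
  shows "u \<otimes>\<^bsub>R\<^esub> u = \<one>\<^bsub>R\<^esub>"
proof -
  let ?d = "group_ring_of z"
  have d: "?d \<in> carrier R" using z by (auto simp: R_carrier group_ring_of_def)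
  have neg: "(\<ominus>\<^bsub>R\<^esub> ?d) x = - ?d x" for x
  proof -
    have "(\<ominus>\<^bsub>R\<^esub> ?d \<oplus>\<^bsub>R\<^esub> ?d) x = \<zero>\<^bsub>R\<^esub> x" using R.l_neg[OF d] by simp
    then show ?thesis by (simp add: R_add) (simp add: integral_group_ring_def)
  qed
  have "?d (inv z) = ?d z" using u sym[OF z] neg by auto
  then have inv: "inv z = z" by (simp add: group_ring_of_def split: if_splits)
  have "?d \<otimes>\<^bsub>R\<^esub> ?d = \<one>\<^bsub>R\<^esub>"
  proof (rule R_eqI)
    fix x assume x: "x \<in> carrier G"
    have "(?d \<otimes>\<^bsub>R\<^esub> ?d) x = (\<Sum>y\<in>carrier G. if y = z then ?d (inv z \<otimes> x) else 0)"
      unfolding R_mult[OF d x] by (rule sum.cong) (auto simp: group_ring_of_def)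
    also have "\<dots> = ?d (z \<otimes> x)" using z finite_carrier inv by simp
    also have "\<dots> = \<one>\<^bsub>R\<^esub> x"
      using x z l_cancel_one[OF z x] by (simp add: group_ring_of_def R_one)
    finally show "(?d \<otimes>\<^bsub>R\<^esub> ?d) x = \<one>\<^bsub>R\<^esub> x" .
  qed (use d in simp_all)
  then show ?thesis using u d by (auto simp: R.l_minus R.r_minus)
qed

text \<open>
  The two cases are the two alternatives for the eigenvalues of the class sum \<open>t\<close> of \<open>x\<close> and \<open>x\<inverse>\<close>.
  Including \<open>x\<inverse>\<close> makes the matrix of \<open>t\<close> symmetric, at the cost that \<open>x\<close> and \<open>x\<inverse>\<close> cannot be told apart:
  this is where \<open>p \<ge> 5\<close> enters.
\<close>

theorem rigid_imp_not_cut: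
  assumes x: "x \<in> carrier G" and p: "prime (ord x)" "ord x \<ge> 5" and rig: "rigid x"
  shows "\<not> cut_property G"
proof
  assume cut: "cut_property G"
  define K where "K = conj_class x \<union> conj_class (inv x)"
  have ix: "inv x \<in> carrier G" using x by simp
  have K: "K \<subseteq> carrier G" using conj_class_subset x ix by (simp add: K_def)
  have Kconj: "g \<otimes> y \<otimes> inv g \<in> K" if "y \<in> K" "g \<in> carrier G" for y g
    using that conj_class_closed x ix by (auto simp: K_def)
  have Kinv': "inv y \<in> K" if "y \<in> K" for y
    using that conj_class_inv[OF x] conj_class_inv[OF ix] x by (auto simp: K_def)
  have Kinv: "inv y \<in> K \<longleftrightarrow> y \<in> K" if "y \<in> carrier G" for y
    using Kinv'[of y] Kinv'[of "inv y"] that by auto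
  define t where "t = indicator_elt K"
  have t: "R_central t" unfolding t_def by (rule indicator_elt_central[OF K Kconj])
  have tR: "t \<in> carrier R" using t by (simp add: R_central_def)
  define T where "T = regular_mat t"
  have T: "T \<in> carrier_mat (order G) (order G)" by (simp add: T_def)
  have tsym: "t (inv y) = t y" if "y \<in> carrier G" for y
    using Kinv[OF that] by (simp add: t_def indicator_elt_def)
  have sym: "transpose_mat T = T"
  proof (rule eq_matI)
    fix i j assume "i < dim_row T" "j < dim_col T"
    then have ij: "i < order G" "j < order G" using T by auto
    have "inv (enum i \<otimes> inv (enum j)) = enum j \<otimes> inv (enum i)" using ij by (simp add: inv_mult_group)
    then show "transpose_mat T $$ (i, j) = T $$ (i, j)"
      using ij tsym[of "enum i \<otimes> inv (enum j)"] by (simp add: T_def regular_mat_def)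
  qed (use T in auto)
  have monic: "lead_coeff (char_poly T) = 1" using degree_monic_char_poly[OF T] by simp
  have tr: "totally_real (char_poly T)" by (rule totally_real_char_poly_symmetric[OF T sym])
  show False
  proof (cases "\<forall>y::real. ipoly (char_poly T) y = 0 \<longrightarrow> y \<in> \<int>")
    case True
    define I where "I = {a. poly (char_poly T) a = 0}"
    have finI: "finite I" unfolding I_def using monic by (intro poly_roots_finite) auto
    \<comment> \<open>The first summand makes \<open>q\<close> exceed the number of elements of \<open>K\<close>, the second one keeps the
      eigenvalues distinct modulo \<open>q\<close>.\<close>
    obtain q where q: "prime q" "q > order G + nat (2 * (\<Sum>a\<in>I. \<bar>a\<bar>))"
      "\<not> [int q = 1] (mod int (ord x))" "\<not> [int q = -1] (mod int (ord x))"
      using exists_large_prime_not_pm1[OF p] by blast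
    have large: "\<not> int q dvd a - b" if "poly (char_poly T) a = 0" "poly (char_poly T) b = 0" "a \<noteq> b" for a b
    proof
      assume "int q dvd a - b"
      then have "int q \<le> \<bar>a - b\<bar>" using that(3) dvd_imp_le_int[of "a - b" "int q"] by simp
      also have "\<dots> \<le> 2 * (\<Sum>a\<in>I. \<bar>a\<bar>)"
        using member_le_sum[of a I "\<lambda>a. \<bar>a\<bar>"] member_le_sum[of b I "\<lambda>a. \<bar>a\<bar>"] finI that
        by (auto simp: I_def)
      also have "\<dots> < int q" using q(2) by linarith
      finally show False by simp
    qed
    obtain e where e: "mat_poly (monom 1 q) T = T + int q \<cdot>\<^sub>m mat_poly e T"
      using symmetric_integer_eigenvalues_frobenius[OF T sym _ q(1) large] True by blast
    obtain u where u: "R_central u" "regular_mat u = mat_poly e T"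
      using regular_mat_poly[OF t] T_def by blast
    have "regular_mat (t [^]\<^bsub>R\<^esub> q) = regular_mat (\<lambda>y. t y + int q * u y)"
    proof -
      have "regular_mat (\<lambda>y. t y + int q * u y) = regular_mat t + int q \<cdot>\<^sub>m regular_mat u"
        by (auto simp: regular_mat_def)
      then show ?thesis using regular_mat_pow[OF tR, of q] e u by (simp add: T_def)
    qed
    then have pw: "(t [^]\<^bsub>R\<^esub> q) y = t y + int q * u y" if "y \<in> carrier G" for y
      using regular_mat_pointwise that by blast
    \<comment> \<open>On this class \<open>t\<close> is 0, whereas the \<open>q\<close>-th powers of elements of \<open>K\<close> meet it at least once and
      at most \<open>|G| < q\<close> times.\<close>
    define C where "C = conj_class (x [^] q)"
    have xq: "x [^] q \<in> carrier G" using x by simp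
    have C: "C \<subseteq> carrier G" using conj_class_subset[OF xq] by (simp add: C_def)
    have disj: "K \<inter> C = {}"
    proof (rule ccontr)
      assume "K \<inter> C \<noteq> {}"
      then obtain y where y: "y \<in> K" "y \<in> C" by blast
      obtain g where g: "g \<in> carrier G" "y = g \<otimes> x [^] q \<otimes> inv g"
        using y(2) by (auto simp: C_def conj_class_def)
      have "inv g \<otimes> y \<otimes> inv (inv g) = x [^] q"
        using g x by (simp add: m_assoc) (simp add: m_assoc[symmetric])
      then have "x [^] q \<in> K" using Kconj[OF y(1), of "inv g"] g(1) by simp
      then consider k where "k \<in> carrier G" "x [^] q = k \<otimes> x \<otimes> inv k"
        | k where "k \<in> carrier G" "x [^] q = k \<otimes> inv x \<otimes> inv k"
        by (auto simp: K_def conj_class_def)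
      then show False
      proof cases
        case (1 k)
        then have "k \<otimes> x \<otimes> inv k = x [^] int q" by (simp add: int_pow_int)
        with rig 1 have "x [^] int q = x [^] (1::int)" using x unfolding rigid_def by (metis int_pow_1)
        then have "[int q = 1] (mod int (ord x))"
          using int_pow_eq[OF x, of "int q" 1] by (simp add: cong_iff_dvd_diff dvd_diff_commute)
        with q(3) show False by blast
      next
        case (2 k)
        have "k \<otimes> x \<otimes> inv k = inv (k \<otimes> inv x \<otimes> inv k)" using 2 x by (simp add: inv_mult_group m_assoc)
        also have "\<dots> = x [^] (- int q)" using 2(2) x by (simp add: int_pow_neg int_pow_int)
        finally have *: "k \<otimes> x \<otimes> inv k = x [^] (- int q)" .
        with rig 2 have "x [^] (- int q) = x [^] (1::int)" using x unfolding rigid_def by (metis int_pow_1)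
        then have "int (ord x) dvd 1 - (- int q)" using int_pow_eq[OF x] by blast
        then have "[int q = -1] (mod int (ord x))"
          by (simp add: cong_iff_dvd_diff add.commute)
        with q(4) show False by blast
      qed
    qed
    define N where "N = card {k\<in>K. k [^] q \<in> C}"
    have "(\<Sum>y\<in>C. (t [^]\<^bsub>R\<^esub> q) y) = (\<Sum>y\<in>C. int q * u y)"
    proof (rule sum.cong[OF refl])
      fix y assume y: "y \<in> C"
      then have "t y = 0" using disj by (auto simp: t_def indicator_elt_def)
      then show "(t [^]\<^bsub>R\<^esub> q) y = int q * u y" using pw y C by auto
    qed
    then have "int q dvd (\<Sum>y\<in>C. (t [^]\<^bsub>R\<^esub> q) y)" by (simp add: sum_distrib_left[symmetric])
    moreover have "[(\<Sum>y\<in>C. (t [^]\<^bsub>R\<^esub> q) y) = int N] (mod int q)"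
      unfolding t_def N_def
      by (rule class_sum_indicator_pow_cong[OF K C _ q(1)])
        (use conj_class_closed[OF xq] in \<open>auto simp: C_def\<close>)
    ultimately have "int q dvd int N" using cong_dvd_iff by blast
    then have qN: "q dvd N" by simp
    have finK: "finite K" using K finite_carrier finite_subset by blast
    have "x \<in> {k\<in>K. k [^] q \<in> C}"
      using conj_class_self[OF x] conj_class_self[OF xq] by (simp add: K_def C_def)
    then have "{k\<in>K. k [^] q \<in> C} \<noteq> {}" by blast
    then have "N > 0" unfolding N_def card_gt_0_iff using finK by simp
    moreover have "N \<le> order G"
      unfolding N_def Coset.order_def by (rule card_mono[OF finite_carrier]) (use K in auto)
    ultimately show False using qN q(2) by (auto dest!: dvd_imp_le)
  next
    case False
    then obtain \<theta> :: real where \<theta>: "ipoly (char_poly T) \<theta> = 0" "\<theta> \<notin> \<int>" by blast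
    obtain P Q :: "int poly"
      where PQ: "\<And>y::real. ipoly (char_poly T) y = 0 \<Longrightarrow> ipoly P y * ipoly Q y = 1"
        and nt: "\<exists>y::real. ipoly (char_poly T) y = 0 \<and> (ipoly P y)\<^sup>2 \<noteq> 1"
      using integer_roots_or_unit[OF monic tr \<theta>] by blast
    obtain u where u: "R_central u" "regular_mat u = mat_poly P T"
      using regular_mat_poly[OF t] T_def by blast
    obtain v where v: "R_central v" "regular_mat v = mat_poly Q T"
      using regular_mat_poly[OF t] T_def by blast
    have uR: "u \<in> carrier R" and vR: "v \<in> carrier R" using u v by (auto simp: R_central_def)
    have "mat_poly (P * Q) T = 1\<^sub>m (order G)"
      unfolding mat_poly_eq_1_iff_symmetric[OF T sym] using PQ by (simp add: of_int_poly_hom.hom_mult)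
    then have "regular_mat (u \<otimes>\<^bsub>R\<^esub> v) = regular_mat \<one>\<^bsub>R\<^esub>"
      by (simp add: regular_mat_mult[OF uR] u v regular_mat_one mat_poly_mult[OF T])
    then have uv: "u \<otimes>\<^bsub>R\<^esub> v = \<one>\<^bsub>R\<^esub>"
      using regular_mat_pointwise uR vR by (intro R_eqI) auto
    moreover have "u \<otimes>\<^bsub>R\<^esub> v = v \<otimes>\<^bsub>R\<^esub> u" using u(1) vR unfolding R_central_def by blast
    ultimately have unit: "u \<in> Units R" using uR vR unfolding Units_def by auto
    have "u \<otimes>\<^bsub>R\<^esub> g = g \<otimes>\<^bsub>R\<^esub> u" if "g \<in> Units R" for g
      using u(1) R.Units_closed[OF that] unfolding R_central_def by blast
    with unit have "u \<in> group_center (units_of R)"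
      unfolding group_center_def units_of_carrier units_of_mult by blast
    then obtain z where "z \<in> group_center G" and z: "u = group_ring_of z \<or> u = \<ominus>\<^bsub>R\<^esub> group_ring_of z"
      using cut unfolding cut_property_def by auto
    then have zG: "z \<in> carrier G" by (simp add: group_center_def)
    have usym: "u (inv y) = u y" if y: "y \<in> carrier G" for y
    proof -
      obtain i j where ij: "i < order G" "j < order G" "y = enum i \<otimes> inv (enum j)"
        using regular_mat_index[OF y] .
      have "transpose_mat (regular_mat u) = regular_mat u"
        unfolding u(2) by (rule mat_poly_transpose[OF T sym])
      then have "regular_mat u $$ (j, i) = regular_mat u $$ (i, j)"
        using ij(1,2) by (metis carrier_matD index_transpose_mat(1) regular_mat_carrier)
      then show ?thesis using ij by (simp add: regular_mat_def inv_mult_group)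
    qed
    have "u \<otimes>\<^bsub>R\<^esub> u = \<one>\<^bsub>R\<^esub>" by (rule symmetric_trivial_unit_square[OF zG z usym])
    then have "mat_poly (P * P) T = 1\<^sub>m (order G)"
      using regular_mat_mult[OF uR, of u] by (simp add: u regular_mat_one mat_poly_mult[OF T])
    then have "\<forall>y::real. ipoly (char_poly T) y = 0 \<longrightarrow> ipoly (P * P) y = 1"
      unfolding mat_poly_eq_1_iff_symmetric[OF T sym] .
    with nt show False by (auto simp: of_int_poly_hom.hom_mult power2_eq_square)
  qed
qed

end

section \<open>Prime divisors of the order of a group with the cut-property\<close>

theorem theorem1:
  fixes G :: "('a, 'b) monoid_scheme"
  assumes "group G" and "finite (carrier G)" and "cut_property G"
  shows "(carrier G \<noteq> {\<one>\<^bsub>G\<^esub>} \<longrightarrow> 2 \<in> order_primes G \<or> 3 \<in> order_primes G) \<and>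
         (nilpotent_group G \<longrightarrow> order_primes G \<subseteq> {2, 3})"
proof -
  interpret finite_group G using assms by (simp add: finite_group_def finite_group_axioms_def)
  have ge5: "p \<ge> 5" if "prime p" "p \<noteq> 2" "p \<noteq> 3" for p :: nat
  proof (rule ccontr)
    assume "\<not> p \<ge> 5"
    then have "p \<in> {0, 1, 2, 3, 4}" by auto
    moreover have "\<not> prime (4::nat)" using prime_product[of 2 "2::nat"] by auto
    ultimately show False using that by auto
  qed
  have no_rigid: "\<not> rigid x" if "x \<in> carrier G" "prime (ord x)" "ord x \<ge> 5" for x
    using rigid_imp_not_cut that assms(3) by blast
  show ?thesis
  proof (intro conjI impI subsetI)
    assume nontriv: "carrier G \<noteq> {\<one>\<^bsub>G\<^esub>}"
    have "order G \<noteq> 1" using nontriv one_closed by (metis card_1_singletonE Coset.order_def singletonD)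
    then obtain l0 where l0: "prime l0 \<and> l0 dvd order G" using prime_factor_nat by blast
    define p where "p = (LEAST l. prime l \<and> l dvd order G)"
    have p: "prime p" "p dvd order G" using LeastI[of "\<lambda>l. prime l \<and> l dvd order G", OF l0] by (simp_all add: p_def)
    have least: "p \<le> l" if "prime l" "l dvd order G" for l
      unfolding p_def using that by (intro Least_le) simp
    show "2 \<in> order_primes G \<or> 3 \<in> order_primes G"
    proof (rule ccontr)
      assume "\<not> ?thesis"
      then have "p \<noteq> 2" "p \<noteq> 3" using p by (auto simp: order_primes_def)
      with ge5 p have "p \<ge> 5" by blast
      moreover obtain x where x: "x \<in> carrier G" "ord x = p"
        using exists_element_of_prime_order[OF finite_carrier p] .
      moreover have "rigid x" using rigid_smallest_prime[OF finite_carrier x(1)] p least x(2) by simp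
      ultimately show False using no_rigid p by blast
    qed
  next
    fix p assume nil: "nilpotent_group G" and "p \<in> order_primes G"
    then have p: "prime p" "p dvd order G" by (auto simp: order_primes_def)
    show "p \<in> {2, 3}"
    proof (rule ccontr)
      assume "p \<notin> {2, 3}"
      with ge5 p have "p \<ge> 5" by blast
      moreover obtain x where x: "x \<in> carrier G" "ord x = p"
        using exists_element_of_prime_order[OF finite_carrier p] .
      moreover have "rigid x" using rigid_nilpotent[OF nil x(1)] p x(2) by simp
      ultimately show False using no_rigid p by blast
    qed
  qed
qed

end
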